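(* Let $\lambda_t>0$ and $\lambda_o>0$ be the densities (per unit area) of transmitters and obstacles, let $\rho_a\in(0,1]$ be the probability that a transmitter is active, let $d_{\max}>0$ be the interference range, let $\theta\in(0,2\pi]$ be the operating beamwidth and $\theta_c>0$ the coherence angle, with $\theta/\theta_c$ a positive integer, and put $\lambda_I=\rho_a\lambda_t\theta/(2\pi)$. In the blockage and interference model described in the context, the collision probability $\rho_c$ equals $$\rho_c = 1-\int_{0}^{d_{\max}}\left(\frac{\lambda_o+\lambda_I e^{-(\lambda_o+\lambda_I)\theta_c d_{\max}^2/2}}{\lambda_o+\lambda_I}\right)^{\lceil\theta/\theta_c\rceil-1}\left(e^{-\lambda_I\theta_c\ell^2/2}-\frac{\lambda_I e^{\lambda_o\theta_c\ell^2/2}}{\lambda_o+\lambda_I}\left(e^{-(\lambda_o+\lambda_I)\theta_c\ell^2/2}-e^{-(\lambda_o+\lambda_I)\theta_c d_{\max}^2/2}\right)\right)\frac{2\ell}{d_{\max}^2}\,d\ell .$$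
   Context: Model. A typical receiver is at the origin of the plane, and its main lobe is a circular sector of angle $\theta$ with apex at the origin. This sector is divided into $k=\lceil\theta/\theta_c\rceil$ sectors $S_1,\dots,S_k$ with apex at the origin, each of angle $\theta_c$ (the ratio $\theta/\theta_c$ is assumed to be an integer). Transmitters form a homogeneous Poisson point process of density $\lambda_t$. Each transmitter is independently active with probability $\rho_a$, and independently has the typical receiver inside its main lobe with probability $\theta/(2\pi)$. Hence the potential interferers (active transmitters whose main lobe contains the receiver) form a homogeneous Poisson point process of density $\lambda_I=\rho_a\lambda_t\theta/(2\pi)$. Obstacles (identified with their centers) form a homogeneous Poisson point process of density $\lambda_o$, independent of the transmitters. Typical link. The typical (intended) transmitter is located, without loss of generality, in sector $S_k$, at distance $L$ from the origin, where $L$ has probability density $f_L(\ell)=2\ell/d_{\max}^2$ on $(0,d_{\max}]$. The typical transmitter is not counted as an interferer. "The typical link of length $\ell$ is established" means that there is no obstacle in $S_k$ within distance $\ell$ of the origin. Blockage. Within each sector, an obstacle at distance $l$ from the origin blocks every interferer of that same sector at distance $\ge l$; obstacles have no effect on other sectors. Thus an interferer in sector $S_i$ at distance $d$ from the origin is in line-of-sight (LoS) condition if and only if $S_i$ contains no obstacle at distance $\le d$. Collision. Given $L=\ell$ and that the typical link is established, a collision occurs if at least one of the sectors $S_1,\dots,S_k$ contains a potential interferer at distance at most $d_{\max}$ from the origin that is in LoS condition. Let $\rho_{c\mid\ell}$ denote the conditional probability of collision given that the typical link at length $\ell$ is established. The collision probability is the average $\rho_c=\int_0^{d_{\max}}\rho_{c\mid\ell}\,f_L(\ell)\,d\ell$.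 Here $d_{\max}$ is treated as a fixed parameter. *)

theory Defs
  imports "HOL-Probability.Probability"
begin

text \<open>
  The library notion \<open>prob_space.indep_var\<close> requires both random variables to take
  values in the same type; this is the same notion without that restriction.
\<close>

definition indep_rv ::
  "'w measure \<Rightarrow> 'a measure \<Rightarrow> ('w \<Rightarrow> 'a) \<Rightarrow> 'b measure \<Rightarrow> ('w \<Rightarrow> 'b) \<Rightarrow> bool" where
  "indep_rv M N f N' g \<longleftrightarrow>
     f \<in> measurable M N \<and> g \<in> measurable M N' \<and>
     prob_space.indep_set M {f -` A \<inter> space M | A. A \<in> sets N} {g -` A \<inter> space M | A. A \<in> sets N'}"

text \<open>
  The plane is the type \<^typ>\<open>complex\<close>. A point process is given by a measurable
  enumeration \<open>X 0, X 1, \<dots>\<close> of its points; a homogeneous Poisson process of positive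
  density on the plane has almost surely infinitely many points, so nothing is lost by
  indexing with all natural numbers. Enumeration makes it possible to attach marks to points.
\<close>

definition point_count :: "(nat \<Rightarrow> 'w \<Rightarrow> complex) \<Rightarrow> complex set \<Rightarrow> 'w \<Rightarrow> nat" where
  "point_count X B w = card {n. X n w \<in> B}"

text \<open>
  The Poisson weights are written out because \<open>poisson_pmf\<close> is only specified for
  positive rates, while \<open>B\<close> may be a null set here. Almost sure local finiteness is
  stated separately because \<open>card\<close> maps infinite sets to 0.
\<close>

definition homogeneous_poisson_process ::
  "'w measure \<Rightarrow> real \<Rightarrow> (nat \<Rightarrow> 'w \<Rightarrow> complex) \<Rightarrow> bool" where
  "homogeneous_poisson_process M lam X \<longleftrightarrow>
     (\<forall>n. X n \<in> borel_measurable M) \<and>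
     (AE w in M. \<forall>r. finite {n. norm (X n w) \<le> r}) \<and>
     (\<forall>B\<in>sets borel. bounded B \<longrightarrow>
        (\<forall>j. measure M {w \<in> space M. point_count X B w = j} =
               (lam * measure lborel B) ^ j / fact j * exp (- (lam * measure lborel B)))) \<and>
     (\<forall>(J :: nat set) B. finite J \<longrightarrow> (\<forall>j\<in>J. B j \<in> sets borel \<and> bounded (B j)) \<longrightarrow>
        disjoint_family_on B J \<longrightarrow>
        prob_space.indep_vars M (\<lambda>_. count_space UNIV) (\<lambda>j. point_count X (B j)) J)"

text \<open>
  The \<open>n\<close>-th transmitter is at \<open>X n\<close>; \<open>A n\<close> says that it is active and \<open>F n\<close> that the
  typical receiver is inside its main lobe. The two mark sequences are merged into one
  family indexed by \<^typ>\<open>nat + nat\<close>.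
\<close>

definition marks ::
  "(nat \<Rightarrow> 'w \<Rightarrow> bool) \<Rightarrow> (nat \<Rightarrow> 'w \<Rightarrow> bool) \<Rightarrow> 'w \<Rightarrow> nat + nat \<Rightarrow> bool" where
  "marks A F w s = case_sum A F s w"

definition independent_marks ::
  "'w measure \<Rightarrow> (nat \<Rightarrow> 'w \<Rightarrow> complex) \<Rightarrow> (nat \<Rightarrow> 'w \<Rightarrow> bool) \<Rightarrow> (nat \<Rightarrow> 'w \<Rightarrow> bool) \<Rightarrow>
   real \<Rightarrow> real \<Rightarrow> bool" where
  "independent_marks M X A F p q \<longleftrightarrow>
     prob_space.indep_vars M (\<lambda>_. count_space UNIV) (\<lambda>s w. marks A F w s) UNIV \<and>
     (\<forall>n. measure M {w \<in> space M. A n w} = p) \<and>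
     (\<forall>n. measure M {w \<in> space M. F n w} = q) \<and>
     indep_rv M (PiM UNIV (\<lambda>_. borel)) (\<lambda>w n. X n w)
                (PiM UNIV (\<lambda>_. count_space UNIV)) (marks A F)"

text \<open>Obstacle positions are given by the enumeration \<open>Y\<close>.\<close>

definition blockage_interference_model ::
  "'w measure \<Rightarrow> (nat \<Rightarrow> 'w \<Rightarrow> complex) \<Rightarrow> (nat \<Rightarrow> 'w \<Rightarrow> bool) \<Rightarrow> (nat \<Rightarrow> 'w \<Rightarrow> bool) \<Rightarrow>
   (nat \<Rightarrow> 'w \<Rightarrow> complex) \<Rightarrow> real \<Rightarrow> real \<Rightarrow> real \<Rightarrow> real \<Rightarrow> bool" where
  "blockage_interference_model M X A F Y lam_t lam_o rho_a \<theta> \<longleftrightarrow>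
     prob_space M \<and>
     homogeneous_poisson_process M lam_t X \<and>
     independent_marks M X A F rho_a (\<theta> / (2 * pi)) \<and>
     homogeneous_poisson_process M lam_o Y \<and>
     indep_rv M (PiM UNIV (\<lambda>_. borel) \<Otimes>\<^sub>M PiM UNIV (\<lambda>_. count_space UNIV))
                (\<lambda>w. (\<lambda>n. X n w, marks A F w))
                (PiM UNIV (\<lambda>_. borel)) (\<lambda>w n. Y n w)"

definition num_sectors :: "real \<Rightarrow> real \<Rightarrow> nat" where
  "num_sectors \<theta> \<theta>c = nat \<lceil>\<theta> / \<theta>c\<rceil>"

text \<open>
  The main lobe of the receiver starts at direction \<open>\<alpha>\<close>. Sectors are half-open in angle
  and omit the apex, so that for \<open>k * \<theta>c = \<theta> \<le> 2 * pi\<close> the sectors \<open>1, \<dots>, k\<close> are pairwise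
  disjoint.
\<close>

definition sector :: "real \<Rightarrow> real \<Rightarrow> nat \<Rightarrow> complex set" where
  "sector \<alpha> \<theta>c i =
     {rcis r t | r t. 0 < r \<and> \<alpha> + (real i - 1) * \<theta>c \<le> t \<and> t < \<alpha> + real i * \<theta>c}"

definition line_of_sight :: "complex set \<Rightarrow> (nat \<Rightarrow> 'w \<Rightarrow> complex) \<Rightarrow> real \<Rightarrow> 'w \<Rightarrow> bool" where
  "line_of_sight S Y d w \<longleftrightarrow> \<not> (\<exists>m. Y m w \<in> S \<and> norm (Y m w) \<le> d)"

definition link_established ::
  "real \<Rightarrow> real \<Rightarrow> real \<Rightarrow> (nat \<Rightarrow> 'w \<Rightarrow> complex) \<Rightarrow> real \<Rightarrow> 'w \<Rightarrow> bool" where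
  "link_established \<alpha> \<theta> \<theta>c Y l w \<longleftrightarrow> line_of_sight (sector \<alpha> \<theta>c (num_sectors \<theta> \<theta>c)) Y l w"

definition collision ::
  "real \<Rightarrow> real \<Rightarrow> real \<Rightarrow> real \<Rightarrow> (nat \<Rightarrow> 'w \<Rightarrow> complex) \<Rightarrow> (nat \<Rightarrow> 'w \<Rightarrow> bool) \<Rightarrow>
   (nat \<Rightarrow> 'w \<Rightarrow> bool) \<Rightarrow> (nat \<Rightarrow> 'w \<Rightarrow> complex) \<Rightarrow> 'w \<Rightarrow> bool" where
  "collision \<alpha> \<theta> \<theta>c dmax X A F Y w \<longleftrightarrow>
     (\<exists>i\<in>{1..num_sectors \<theta> \<theta>c}. \<exists>n.
        A n w \<and> F n w \<and> X n w \<in> sector \<alpha> \<theta>c i \<and> norm (X n w) \<le> dmax \<and>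
        line_of_sight (sector \<alpha> \<theta>c i) Y (norm (X n w)) w)"

definition link_length_density :: "real \<Rightarrow> real \<Rightarrow> real" where
  "link_length_density dmax l = (if 0 < l \<and> l \<le> dmax then 2 * l / dmax\<^sup>2 else 0)"

definition cond_collision_prob ::
  "'w measure \<Rightarrow> real \<Rightarrow> real \<Rightarrow> real \<Rightarrow> real \<Rightarrow> (nat \<Rightarrow> 'w \<Rightarrow> complex) \<Rightarrow> (nat \<Rightarrow> 'w \<Rightarrow> bool) \<Rightarrow>
   (nat \<Rightarrow> 'w \<Rightarrow> bool) \<Rightarrow> (nat \<Rightarrow> 'w \<Rightarrow> complex) \<Rightarrow> real \<Rightarrow> real" where
  "cond_collision_prob M \<alpha> \<theta> \<theta>c dmax X A F Y l =
     \<P>(w in M. collision \<alpha> \<theta> \<theta>c dmax X A F Y w \<bar> link_established \<alpha> \<theta> \<theta>c Y l w)"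

definition collision_prob ::
  "'w measure \<Rightarrow> real \<Rightarrow> real \<Rightarrow> real \<Rightarrow> real \<Rightarrow> (nat \<Rightarrow> 'w \<Rightarrow> complex) \<Rightarrow> (nat \<Rightarrow> 'w \<Rightarrow> bool) \<Rightarrow>
   (nat \<Rightarrow> 'w \<Rightarrow> bool) \<Rightarrow> (nat \<Rightarrow> 'w \<Rightarrow> complex) \<Rightarrow> real" where
  "collision_prob M \<alpha> \<theta> \<theta>c dmax X A F Y =
     (LBINT l=0..dmax. cond_collision_prob M \<alpha> \<theta> \<theta>c dmax X A F Y l * link_length_density dmax l)"

end

theory Submission
  imports Defs
begin

text \<open>
  Conditioning on the obstacles, the absence of a collision is a void event of the thinned
  transmitter process, so its conditional probability is \<open>exp (- lam_I * area)\<close>, where the area is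
  that of the part of the main lobe in line of sight. In the \<open>i\<close>-th sector this part is, up to a
  null set, the sector cut off at the distance \<open>D i\<close> of the nearest obstacle (capped at \<open>dmax\<close>), so
  its area is \<open>\<theta>c * (D i)\<^sup>2 / 2\<close>. The \<open>D i\<close> are independent with tails \<open>exp (- lam_o * \<theta>c * r\<^sup>2 / 2)\<close>,
  and the link is established exactly if \<open>l \<le> D k\<close> almost surely, so the expectation factorises into
  one-dimensional integrals.
\<close>

section \<open>Area of circular sectors\<close>

text \<open>The closed form arises sector by sector. With \<open>b = lam_o * \<theta>c / 2\<close>
  and \<open>c = lam_I * \<theta>c / 2\<close>, a sector contributes the expectation of
  \<open>exp (- (c * D\<^sup>2))\<close> on the event \<open>l \<le> D\<close>, which is
  \<open>phi l\<close>. The link constrains only the last sector, so the others give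
  \<open>phi 0\<close> each, hence the power in the formula; dividing the last factor by the link
  probability \<open>exp (- (b * l\<^sup>2))\<close> produces the growing exponential in the
  integrand.

  The processes are known only through an enumeration and through the joint law of counts in bounded
  Borel sets. Therefore the thinned process is never shown to be Poisson: its void probability is
  the generating function of a Poisson count at \<open>1 - p * q\<close>. Likewise the independence
  of the distances comes from void events on disjoint truncated sectors. Conditioning on obstacles
  means Fubini for the joint law, so obstacle configurations are treated as fixed functions
  \<open>y\<close>. Differences between strict and non-strict inequalities are absorbed by null
  circles.\<close>

text \<open>The library has invariance of Lebesgue measure under orthogonal maps only on \<open>real^'n\<close>.\<close>

definition complex_of_vec :: "real^2 \<Rightarrow> complex" where
  "complex_of_vec v = Complex (v $ 1) (v $ 2)"

lemma complex_of_vec_measurable [measurable]: "complex_of_vec \<in> borel_measurable borel"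
proof -
  have "continuous_on UNIV complex_of_vec"
    unfolding complex_of_vec_def Complex_eq by (intro continuous_intros)
  then show ?thesis by (rule borel_measurable_continuous_onI)
qed

text \<open>Lebesgue measure is determined by its values on boxes, and the preimage of a box is the
  box whose corners have the real and imaginary parts as coordinates.\<close>

lemma lborel_eq_distr_complex_of_vec: "lborel = distr lborel borel complex_of_vec"
proof (rule lborel_eqI)
  fix l u :: complex
  assume le: "\<And>b. b \<in> Basis \<Longrightarrow> l \<bullet> b \<le> u \<bullet> b"
  have le': "Re l \<le> Re u" "Im l \<le> Im u"
    using le[of 1] le[of \<i>] by (auto simp: Basis_complex_def)
  have eq: "complex_of_vec -` box l u = box (vector [Re l, Im l]) (vector [Re u, Im u])"
    unfolding set_eq_iff vimage_eq mem_box_cart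
    by (auto simp: complex_of_vec_def box_def Basis_complex_def forall_2)
  show "emeasure (distr lborel borel complex_of_vec) (box l u) = (\<Prod>b\<in>Basis. (u - l) \<bullet> b)"
    using le' by (subst emeasure_distr)
      (auto simp: eq emeasure_lborel_box_eq Basis_vec_def cart_eq_inner_axis[symmetric] inner_axis
         UNIV_2 Basis_complex_def axis_eq_axis inner_diff_left)
qed simp

text \<open>Carried over to \<open>real^2\<close>, multiplication by \<open>c\<close> becomes the
  map \<open>f\<close>, which is linear and preserves norms, hence orthogonal. Boundedness of
  \<open>S\<close> makes its preimage Lebesgue measurable with finite measure, as the invariance
  theorem requires.\<close>

lemma measure_lborel_complex_rotation:
  fixes c :: complex
  assumes c: "cmod c = 1" and S: "S \<in> sets borel" and "bounded S"
  shows "measure lborel ((*) c ` S) = measure lborel S"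
proof -
  define f where "f v = (vector [Re (c * complex_of_vec v), Im (c * complex_of_vec v)] :: real^2)" for v
  have h_f: "complex_of_vec (f v) = c * complex_of_vec v" for v
    by (simp add: f_def complex_of_vec_def complex_eq_iff)
  have norm_h: "cmod (complex_of_vec v) = norm v" for v
    by (simp add: complex_of_vec_def cmod_def norm_vec_def L2_set_def UNIV_2)
  have "linear f"
    by (rule linearI) (auto simp: f_def complex_of_vec_def vec_eq_iff forall_2 algebra_simps)
  moreover have "norm (f v) = norm v" for v
    using c by (simp flip: norm_h add: h_f norm_mult)
  ultimately have f: "orthogonal_transformation f"
    by (simp add: orthogonal_transformation)
  have inj_h: "complex_of_vec v = complex_of_vec w \<longleftrightarrow> v = w" for v w
    by (auto simp: complex_of_vec_def vec_eq_iff forall_2)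
  have surj_h: "\<exists>v. complex_of_vec v = z" for z
    by (rule exI[of _ "vector [Re z, Im z]"]) (simp add: complex_of_vec_def)
  have c0: "c \<noteq> 0" using c by auto
  have meas: "measure lborel T = measure lebesgue (complex_of_vec -` T)" if "T \<in> sets borel" for T
    using that measurable_sets[OF complex_of_vec_measurable, of T]
    by (subst lborel_eq_distr_complex_of_vec) (simp add: measure_distr measure_completion)
  have rot: "(*) c ` S = (\<lambda>z. z / c) -` S"
    using c0 by (force simp: image_iff)
  have cS: "(*) c ` S \<in> sets borel"
    unfolding rot using measurable_sets_borel[OF _ S, of "\<lambda>z. z / c"] by simp
  have vS: "complex_of_vec -` S \<in> sets borel"
    using measurable_sets[OF complex_of_vec_measurable S] by simp
  have bS: "bounded (complex_of_vec -` S)"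
    using \<open>bounded S\<close> unfolding bounded_iff norm_h[symmetric] by auto
  have eq: "complex_of_vec -` ((*) c ` S) = f ` (complex_of_vec -` S)"
  proof (intro set_eqI iffI)
    fix v assume "v \<in> complex_of_vec -` ((*) c ` S)"
    then obtain z where z: "z \<in> S" "complex_of_vec v = c * z" by auto
    obtain w where "complex_of_vec w = z" using surj_h by blast
    with z have "w \<in> complex_of_vec -` S" "v = f w" by (auto simp: inj_h[symmetric] h_f)
    then show "v \<in> f ` (complex_of_vec -` S)" by blast
  qed (auto simp: h_f)
  show ?thesis
    unfolding meas[OF cS] meas[OF S] eq
    using vS bS by (intro measure_orthogonal_image f bounded_set_imp_lmeasurable) auto
qed

section \<open>Angular wedges: measurability, disjointness and area\<close>

definition wedge :: "real \<Rightarrow> real \<Rightarrow> complex set" where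
  "wedge a b = {rcis r t | r t. 0 < r \<and> a \<le> t \<and> t < b}"

lemma sector_eq_wedge: "sector \<alpha> \<theta>c i = wedge (\<alpha> + (real i - 1) * \<theta>c) (\<alpha> + real i * \<theta>c)"
  by (simp add: sector_def wedge_def)

text \<open>Polar coordinates are continuous, so the images \<open>K n\<close> of closed rectangles
  are compact. The rectangles stay away from radius 0 and from the excluded angle \<open>b\<close>
  by \<open>1 / real (Suc n)\<close>, and they exhaust the wedge.\<close>

lemma wedge_borel [measurable]: "wedge a b \<in> sets borel"
proof -
  define K where "K n = (\<lambda>p. rcis (fst p) (snd p)) ` ({1 / real (Suc n)..real (Suc n)} \<times> {a..b - 1 / real (Suc n)})" for n
  have "compact (K n)" for n
    unfolding K_def rcis_def cis_conv_exp by (intro compact_continuous_image compact_Times continuous_intros) auto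
  moreover have "wedge a b = (\<Union>n. K n)"
  proof (intro set_eqI iffI)
    fix z assume "z \<in> wedge a b"
    then obtain r t where rt: "z = rcis r t" "0 < r" "a \<le> t" "t < b" by (auto simp: wedge_def)
    obtain n where n: "max r (max (1 / r) (1 / (b - t))) < real n" using reals_Archimedean2 by blast
    then have "r \<le> real (Suc n)" "1 / r < real (Suc n)" "1 / (b - t) < real (Suc n)" by auto
    then have "r \<le> real (Suc n)" "1 / real (Suc n) \<le> r" "1 / real (Suc n) \<le> b - t"
      using rt by (auto simp: field_simps)
    then have "(r, t) \<in> {1 / real (Suc n)..real (Suc n)} \<times> {a..b - 1 / real (Suc n)}"
      using rt by auto
    then show "z \<in> (\<Union>n. K n)" unfolding K_def rt(1) by force
  next
    fix z assume "z \<in> (\<Union>n. K n)"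
    then obtain n r t where *: "z = rcis r t" "1 / real (Suc n) \<le> r" "a \<le> t" "t \<le> b - 1 / real (Suc n)"
      by (auto simp: K_def)
    have "0 < 1 / real (Suc n)" by simp
    with * have "0 < r" "t < b" by linarith+
    with * show "z \<in> wedge a b" by (auto simp: wedge_def)
  qed
  ultimately show ?thesis by (auto intro: borel_compact)
qed

lemma wedge_rotate: "(*) (cis c) ` wedge a b = wedge (a + c) (b + c)"
proof (intro set_eqI iffI)
  fix z assume "z \<in> (*) (cis c) ` wedge a b"
  then obtain r t where "z = cis c * rcis r t" "0 < r" "a \<le> t" "t < b" by (auto simp: wedge_def)
  then have "z = rcis r (t + c)" by (simp add: rcis_def cis_mult mult_ac add_ac)
  with \<open>0 < r\<close> \<open>a \<le> t\<close> \<open>t < b\<close> show "z \<in> wedge (a + c) (b + c)"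
    unfolding wedge_def by (intro CollectI exI[of _ r] exI[of _ "t + c"]) auto
next
  fix z assume "z \<in> wedge (a + c) (b + c)"
  then obtain r t where *: "z = rcis r t" "0 < r" "a + c \<le> t" "t < b + c" by (auto simp: wedge_def)
  then have "z = cis c * rcis r (t - c)" by (simp add: rcis_def cis_mult)
  moreover have "rcis r (t - c) \<in> wedge a b"
    unfolding wedge_def using * by (intro CollectI exI[of _ r] exI[of _ "t - c"]) auto
  ultimately show "z \<in> (*) (cis c) ` wedge a b" by blast
qed

lemma rcis_eq_imp:
  assumes "rcis r s = rcis r' t" "0 < r" "0 < r'" "\<bar>s - t\<bar> < 2 * pi"
  shows "s = t"
proof -
  have "cmod (rcis r s) = cmod (rcis r' t)" using assms(1) by (rule arg_cong)
  then have "r = r'" using assms(2,3) by simp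
  then have "cis s = cis t" using assms by (simp add: rcis_def)
  then have "cis (s - t) = 1" by (metis cis_divide cis_neq_zero divide_self)
  then have "cos (s - t) = 1" by (metis cis.sel(1) one_complex.sel(1))
  then obtain n :: int where n: "s - t = of_int n * 2 * pi"
    using cos_one_2pi_int by blast
  have "\<bar>of_int n\<bar> * (2 * pi) < 1 * (2 * pi)" using assms(4) unfolding n by (simp add: abs_mult)
  then have "\<bar>of_int n :: real\<bar> < 1" by (subst (asm) mult_less_cancel_right_pos) auto
  then have "n = 0" by linarith
  with n show ?thesis by simp
qed

text \<open>The bound \<open>d \<le> a + 2 * pi\<close> rules out wrapping around: angles of a
  common point would differ by less than a full turn, hence be equal, although one lies below
  \<open>b\<close> and the other is at least \<open>c\<close>.\<close>

lemma wedge_disjoint: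
  assumes "b \<le> c" "d \<le> a + 2 * pi"
  shows "wedge a b \<inter> wedge c d = {}"
proof (rule ccontr)
  assume "wedge a b \<inter> wedge c d \<noteq> {}"
  then obtain r s r' t where "rcis r s = rcis r' t" "0 < r" "0 < r'" "a \<le> s" "s < b" "c \<le> t" "t < d"
    by (auto simp: wedge_def)
  moreover from this assms have "s = t" by (intro rcis_eq_imp[of r s r' t]) auto
  ultimately show False using assms by auto
qed

lemma wedge_Un: "a \<le> b \<Longrightarrow> b \<le> c \<Longrightarrow> wedge a b \<union> wedge b c = wedge a c"
  unfolding wedge_def by (auto; metis less_le_trans not_le)

lemma wedge_full: "wedge (- pi) pi = - {0}"
proof -
  have "z \<in> wedge (- pi) pi" if "z \<noteq> 0" for z
  proof -
    \<comment> \<open>\<open>Arg\<close> takes values in the interval open at \<open>- pi\<close>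
      and closed at \<open>pi\<close>, whereas the wedge includes its lower angle and excludes its
      upper one; the value \<open>pi\<close> therefore has to be moved to
      \<open>- pi\<close>.\<close>
    define t where "t = (if Arg z = pi then - pi else Arg z)"
    have "cis t = cis (Arg z)" by (auto simp: t_def complex_eq_iff)
    then have "z = rcis (cmod z) t" by (metis rcis_cmod_Arg rcis_def)
    moreover have "- pi \<le> t" "t < pi"
      using Arg_bounded[of z] by (auto simp: t_def)
    ultimately show ?thesis using that unfolding wedge_def by fastforce
  qed
  moreover have "0 \<notin> wedge (- pi) pi" by (auto simp: wedge_def)
  ultimately show ?thesis by auto
qed

text \<open>
  Cauchy's functional equation; nonnegativity makes \<open>g\<close> monotone, so no continuity is required.
\<close>

lemma additive_nonneg_imp_linear:
  fixes g :: "real \<Rightarrow> real"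
  assumes add: "\<And>s t. 0 \<le> s \<Longrightarrow> 0 \<le> t \<Longrightarrow> s + t \<le> T \<Longrightarrow> g (s + t) = g s + g t"
    and nonneg: "\<And>t. 0 \<le> g t" and T: "0 < T" and t: "0 \<le> t" "t \<le> T"
  shows "g t = t / T * g T"
proof -
  have g0: "g 0 = 0" using add[of 0 0] T by simp
  have mult: "g (real n * x) = real n * g x" if "0 \<le> x" "real n * x \<le> T" for n x
    using that
  proof (induction n)
    case 0 show ?case by (simp add: g0)
  next
    case (Suc n)
    have "g (real (Suc n) * x) = g (real n * x + x)" by (simp add: algebra_simps)
    also have "\<dots> = g (real n * x) + g x"
      using Suc.prems by (intro add) (auto simp: algebra_simps)
    also have "g (real n * x) = real n * g x"
      using Suc.prems by (intro Suc.IH) (auto simp: algebra_simps)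
    finally show ?case by (simp add: algebra_simps)
  qed
  \<comment> \<open>On the grid of mesh \<open>x = T / real (Suc n)\<close>, both \<open>g t\<close>
    and the linear value lie between \<open>real m * g x\<close> and
    \<open>(real m + 1) * g x\<close>, where \<open>m\<close> is the number of whole steps below
    \<open>t\<close>. They thus differ by at most \<open>g x\<close>, which is the
    \<open>Suc n\<close>-th part of \<open>g T\<close>.\<close>
  have bound: "\<bar>g t - t / T * g T\<bar> \<le> g T / real (Suc n)" for n
  proof -
    define x where "x = T / real (Suc n)"
    have x: "0 < x" "real (Suc n) * x = T" using T by (auto simp: x_def)
    have gx: "g T = real (Suc n) * g x" using mult[of x "Suc n"] x by simp
    define m where "m = nat \<lfloor>t / x\<rfloor>"
    have "real m \<le> t / x" "t / x < real m + 1" using t x by (auto simp: m_def)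
    then have m: "real m * x \<le> t" "t \<le> real m * x + x" using x by (auto simp: field_simps)
    have 1: "g t = real m * g x + g (t - real m * x)"
      using add[of "real m * x" "t - real m * x"] mult[of x m] m x t by simp
    have 2: "g (t - real m * x) \<le> g x"
    proof -
      have "x \<le> T" unfolding x_def using T by (simp add: field_simps)
      then have "g x = g (t - real m * x) + g (x - (t - real m * x))"
        using add[of "t - real m * x" "x - (t - real m * x)"] m x by simp
      with nonneg show ?thesis by (metis le_add_same_cancel1)
    qed
    have 3: "t / T * g T = t / x * g x" unfolding gx using x by (simp add: x_def)
    have "real m * g x \<le> t / x * g x" "t / x * g x \<le> (real m + 1) * g x"
      using \<open>real m \<le> t / x\<close> \<open>t / x < real m + 1\<close> nonneg[of x] by (intro mult_right_mono; simp)+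
    then have "\<bar>g t - t / T * g T\<bar> \<le> g x"
      unfolding 1 3 using 2 nonneg[of "t - real m * x"] by (simp add: algebra_simps abs_le_iff)
    also have "g x = g T / real (Suc n)" unfolding gx by simp
    finally show ?thesis .
  qed
  have "(\<lambda>n. g T / real (Suc n)) \<longlonglongrightarrow> 0"
    using LIMSEQ_Suc[OF lim_const_over_n] by blast
  then have "\<bar>g t - t / T * g T\<bar> \<le> 0"
    by (rule tendsto_lowerbound) (use bound in auto)
  then show ?thesis by simp
qed

text \<open>For fixed \<open>r\<close> the area depends only on the opening angle, by rotation, and
  is additive in it, so it is linear on \<open>[0, 2 * pi]\<close>. The slope comes from the full
  turn, which is the disc without its centre.\<close>

lemma measure_wedge_ball:
  assumes "a \<le> b" "b \<le> a + 2 * pi" "0 \<le> r"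
  shows "measure lborel (wedge a b \<inter> ball 0 r) = (b - a) * r\<^sup>2 / 2"
proof -
  define f where "f a b = measure lborel (wedge a b \<inter> ball 0 r)" for a b
  have rot: "f (a + c) (b + c) = f a b" for a b c
  proof -
    have "(*) (cis c) ` (wedge a b \<inter> ball 0 r) = wedge (a + c) (b + c) \<inter> ball 0 r"
      unfolding wedge_rotate[symmetric] by (auto simp: image_iff norm_mult)
    then show ?thesis
      unfolding f_def using measure_lborel_complex_rotation[of "cis c" "wedge a b \<inter> ball 0 r"]
      by (auto simp: bounded_Int)
  qed
  have fm: "wedge a b \<inter> ball 0 r \<in> fmeasurable lborel" for a b
    by (intro fmeasurableI emeasure_bounded_finite bounded_Int) auto
  have add: "f a b + f b c = f a c" if "a \<le> b" "b \<le> c" "c \<le> a + 2 * pi" for a b c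
  proof -
    have "f a c = measure lborel ((wedge a b \<inter> ball 0 r) \<union> (wedge b c \<inter> ball 0 r))"
      unfolding f_def wedge_Un[OF that(1,2), symmetric] by (simp add: Int_Un_distrib2)
    also have "\<dots> = f a b + f b c"
      unfolding f_def using wedge_disjoint[of b b c a] that
      by (intro measure_Un_AE) (auto simp: fm)
    finally show ?thesis by simp
  qed
  have "f 0 (b - a) = (b - a) / (2 * pi) * f 0 (2 * pi)"
  proof (rule additive_nonneg_imp_linear)
    fix s t :: real assume "0 \<le> s" "0 \<le> t" "s + t \<le> 2 * pi"
    then show "f 0 (s + t) = f 0 s + f 0 t"
      using add[of 0 s "s + t"] rot[of 0 s t] by (simp add: add_ac)
  qed (use assms in \<open>auto simp: f_def\<close>)
  also have "f 0 (2 * pi) = f (- pi) pi"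
    using rot[of "- pi" pi pi] by simp
  also have "\<dots> = measure lborel (ball (0::complex) r)"
  proof -
    have "wedge (- pi) pi \<inter> ball 0 r = ball 0 r - {0}" by (auto simp: wedge_full)
    then show ?thesis unfolding f_def
      by (simp add: measure_def emeasure_Diff_null_set null_sets_def)
  qed
  also have "\<dots> = pi * r\<^sup>2"
    using assms by (simp add: content_ball unit_ball_vol_2 DIM_complex)
  also have "f 0 (b - a) = f a b"
    using rot[of 0 a "b - a"] by simp
  finally show ?thesis by (simp add: f_def)
qed

lemma sphere_null_sets_lborel: "sphere (a :: complex) r \<in> null_sets lborel"
  using negligible_sphere[of a r]
  by (simp add: negligible_iff_null_sets null_sets_completion_iff borel_closed)

text \<open>The two bounds differ by part of a circle, which is null. This covers visible regions,
  which are open at an obstacle but closed at the interference range.\<close>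

lemma measure_wedge_between_balls:
  assumes "a \<le> b" "b \<le> a + 2 * pi" "0 \<le> r" and T: "T \<in> sets borel"
    and "wedge a b \<inter> ball 0 r \<subseteq> T" "T \<subseteq> wedge a b \<inter> cball 0 r"
  shows "measure lborel T = (b - a) * r\<^sup>2 / 2"
proof -
  have "AE x in lborel. x \<in> T \<longleftrightarrow> x \<in> wedge a b \<inter> ball 0 r"
    using AE_not_in[OF sphere_null_sets_lborel[of 0 r]]
  proof eventually_elim
    fix x :: complex assume "x \<notin> sphere 0 r"
    then have "x \<in> cball 0 r \<longleftrightarrow> x \<in> ball 0 r" by auto
    with assms show "x \<in> T \<longleftrightarrow> x \<in> wedge a b \<inter> ball 0 r" by blast
  qed
  then have "measure lborel T = measure lborel (wedge a b \<inter> ball 0 r)"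
    by (rule measure_eq_AE) (use T in auto)
  with measure_wedge_ball[OF assms(1-3)] show ?thesis by simp
qed

section \<open>Thinned Poisson processes and their void probabilities\<close>

lemma (in prob_space) indep_rv_distr_pair:
  assumes "indep_rv M N f N' g"
  shows "distr M (N \<Otimes>\<^sub>M N') (\<lambda>w. (f w, g w)) = distr M N f \<Otimes>\<^sub>M distr M N' g"
proof -
  have f [measurable]: "f \<in> measurable M N" and g [measurable]: "g \<in> measurable M N'"
    and ind: "indep_set {f -` A \<inter> space M | A. A \<in> sets N} {g -` A \<inter> space M | A. A \<in> sets N'}"
    using assms by (auto simp: indep_rv_def)
  interpret f: prob_space "distr M N f" by (rule prob_space_distr) fact
  interpret g: prob_space "distr M N' g" by (rule prob_space_distr) fact
  show ?thesis
  proof (rule pair_measure_eqI[symmetric])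
    fix A B assume "A \<in> sets (distr M N f)" "B \<in> sets (distr M N' g)"
    then have [measurable]: "A \<in> sets N" "B \<in> sets N'" by auto
    have "prob ((f -` A \<inter> space M) \<inter> (g -` B \<inter> space M))
        = prob (f -` A \<inter> space M) * prob (g -` B \<inter> space M)"
      by (rule indep_setD[OF ind]) auto
    moreover have "(\<lambda>w. (f w, g w)) -` (A \<times> B) \<inter> space M = (f -` A \<inter> space M) \<inter> (g -` B \<inter> space M)"
      by auto
    ultimately show "emeasure (distr M N f) A * emeasure (distr M N' g) B
        = emeasure (distr M (N \<Otimes>\<^sub>M N') (\<lambda>w. (f w, g w))) (A \<times> B)"
      by (simp add: emeasure_distr emeasure_eq_measure ennreal_mult)
  qed (auto intro: f.sigma_finite_measure_axioms g.sigma_finite_measure_axioms)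
qed

text \<open>Fubini for the product law, with either component frozen: the first form is used to
  average over positions with random marks, the second to average over obstacles with random
  transmitters.\<close>

lemma (in prob_space) emeasure_indep_rv:
  assumes "indep_rv M N f N' g" and Q [measurable]: "Q \<in> sets (N \<Otimes>\<^sub>M N')"
  shows "emeasure M {w \<in> space M. (f w, g w) \<in> Q}
      = (\<integral>\<^sup>+w. emeasure M {w' \<in> space M. (f w, g w') \<in> Q} \<partial>M)" (is "?L = ?R1")
    and "emeasure M {w \<in> space M. (f w, g w) \<in> Q}
      = (\<integral>\<^sup>+w. emeasure M {w' \<in> space M. (f w', g w) \<in> Q} \<partial>M)" (is "_ = ?R2")
proof -
  have f [measurable]: "f \<in> measurable M N" and g [measurable]: "g \<in> measurable M N'"
    using assms by (auto simp: indep_rv_def)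
  interpret f: prob_space "distr M N f" by (rule prob_space_distr) fact
  interpret g: prob_space "distr M N' g" by (rule prob_space_distr) fact
  interpret fg: pair_prob_space "distr M N f" "distr M N' g" ..
  have Q': "Q \<in> sets (distr M N f \<Otimes>\<^sub>M distr M N' g)" using Q by simp
  have L: "?L = emeasure (distr M N f \<Otimes>\<^sub>M distr M N' g) Q"
    unfolding indep_rv_distr_pair[OF assms(1), symmetric]
    by (subst emeasure_distr) (auto intro!: arg_cong[where f="emeasure M"])
  have sec1: "Pair x -` Q \<in> sets N'" for x using Q by (rule sets_Pair1)
  have sec2: "(\<lambda>x. (x, y)) -` Q \<in> sets N" for y using Q by (rule sets_Pair2)
  have m1: "(\<lambda>x. emeasure (distr M N' g) (Pair x -` Q)) \<in> borel_measurable (distr M N f)"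
    using g.measurable_emeasure_Pair[of Q N] by simp
  have m2: "(\<lambda>y. emeasure (distr M N f) ((\<lambda>x. (x, y)) -` Q)) \<in> borel_measurable (distr M N' g)"
    using fg.measurable_emeasure_Pair2[OF Q'] by simp
  show "?L = ?R1"
    unfolding L g.emeasure_pair_measure_alt[OF Q'] nn_integral_distr[OF f m1]
    by (intro nn_integral_cong) (auto simp: emeasure_distr sec1 intro!: arg_cong[where f="emeasure M"])
  show "?L = ?R2"
    unfolding L fg.emeasure_pair_measure_alt2[OF Q'] nn_integral_distr[OF g m2]
    by (intro nn_integral_cong) (auto simp: emeasure_distr sec2 intro!: arg_cong[where f="emeasure M"])
qed

text \<open>Grouping the family over \<open>nat + nat\<close> into the disjoint blocks
  \<open>{Inl n, Inr n}\<close> makes the conjunctions \<open>A n w \<and> F n w\<close> independent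
  over \<open>n\<close>, each of probability \<open>p * q\<close>.\<close>

lemma (in prob_space) prob_no_marked_point:
  assumes ind: "indep_vars (\<lambda>_. count_space UNIV) (\<lambda>s w. marks A F w s) UNIV"
    and p: "\<And>n. prob {w \<in> space M. A n w} = p" and q: "\<And>n. prob {w \<in> space M. F n w} = q"
    and "finite J"
  shows "prob {w \<in> space M. \<forall>n\<in>J. \<not> (A n w \<and> F n w)} = (1 - p * q) ^ card J"
proof -
  have m: "(\<lambda>w. marks A F w s) \<in> measurable M (count_space UNIV)" for s
    using ind by (auto simp: indep_vars_def)
  have [measurable]: "Measurable.pred M (A n)" "Measurable.pred M (F n)" for n
    using m[of "Inl n"] m[of "Inr n"] by (simp_all add: marks_def)
  have "prob (\<Inter>s\<in>{Inl n, Inr n}. (\<lambda>w. marks A F w s) -` {True} \<inter> space M)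
      = (\<Prod>s\<in>{Inl n, Inr n}. prob ((\<lambda>w. marks A F w s) -` {True} \<inter> space M))" for n
    by (rule indep_varsD[OF ind]) auto
  then have "prob {w \<in> space M. A n w \<and> F n w} = prob {w \<in> space M. A n w} * prob {w \<in> space M. F n w}" for n
    by (simp add: marks_def vimage_def Int_def conj_ac cong: conj_cong)
  then have AF: "prob {w \<in> space M. A n w \<and> F n w} = p * q" for n by (simp add: p q)
  have nAF: "prob {w \<in> space M. \<not> (A n w \<and> F n w)} = 1 - p * q" for n
    using prob_neg[of "\<lambda>w. A n w \<and> F n w"] by (simp only: AF) simp
  have "indep_vars (\<lambda>n. PiM {Inl n, Inr n} (\<lambda>_. count_space UNIV))
      (\<lambda>n w. restrict (\<lambda>s. marks A F w s) {Inl n, Inr n}) UNIV"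
    by (rule indep_vars_restrict[OF ind]) (auto simp: disjoint_family_on_def)
  then have "indep_vars (\<lambda>_. count_space UNIV)
      (\<lambda>n w. (\<lambda>h. h (Inl n) \<and> h (Inr n)) (restrict (\<lambda>s. marks A F w s) {Inl n, Inr n})) UNIV"
  proof (rule indep_vars_compose2)
    fix n :: nat
    have [measurable]: "(\<lambda>h. h (Inl n)) \<in> measurable (PiM {Inl n, Inr n} (\<lambda>_. count_space UNIV)) (count_space (UNIV :: bool set))"
      "(\<lambda>h. h (Inr n)) \<in> measurable (PiM {Inl n, Inr n} (\<lambda>_. count_space UNIV)) (count_space (UNIV :: bool set))"
      by (rule measurable_component_singleton; simp)+
    show "(\<lambda>h. h (Inl n) \<and> h (Inr n)) \<in> measurable (PiM {Inl n, Inr n} (\<lambda>_. count_space UNIV)) (count_space UNIV)"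
      by measurable
  qed
  then have ind': "indep_vars (\<lambda>_. count_space UNIV) (\<lambda>n w. A n w \<and> F n w) UNIV"
    by (simp add: marks_def)
  show ?thesis
  proof (cases "J = {}")
    case True then show ?thesis by (simp add: prob_space)
  next
    case False
    have "prob (\<Inter>n\<in>J. (\<lambda>w. A n w \<and> F n w) -` {False} \<inter> space M)
      = (\<Prod>n\<in>J. prob ((\<lambda>w. A n w \<and> F n w) -` {False} \<inter> space M))"
      by (rule indep_varsD[OF ind' False \<open>finite J\<close>]) auto
    moreover have "(\<Inter>n\<in>J. (\<lambda>w. A n w \<and> F n w) -` {False} \<inter> space M) = {w \<in> space M. \<forall>n\<in>J. \<not> (A n w \<and> F n w)}"
      using False by auto
    moreover have "(\<lambda>w. A n w \<and> F n w) -` {False} \<inter> space M = {w \<in> space M. \<not> (A n w \<and> F n w)}" for n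
      by auto
    ultimately show ?thesis by (simp only: nAF prod_constant)
  qed
qed

section \<open>Poisson counts and void events of the thinned process\<close>

lemma (in prob_space) poisson_indep_counts:
  assumes "homogeneous_poisson_process M lam X" "finite (J :: nat set)" "disjoint_family_on B J"
    and "\<And>j. j \<in> J \<Longrightarrow> B j \<in> sets borel" "\<And>j. j \<in> J \<Longrightarrow> bounded (B j)"
  shows "indep_vars (\<lambda>_. count_space UNIV) (\<lambda>j. point_count X (B j)) J"
proof -
  have "\<forall>(J :: nat set) B. finite J \<longrightarrow> (\<forall>j\<in>J. B j \<in> sets borel \<and> bounded (B j)) \<longrightarrow>
      disjoint_family_on B J \<longrightarrow> indep_vars (\<lambda>_. count_space UNIV) (\<lambda>j. point_count X (B j)) J"
    using assms(1) unfolding homogeneous_poisson_process_def by (elim conjE)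
  from this[rule_format, of J B] assms(2-) show ?thesis by simp
qed

text \<open>Measurability of a count is contained in the independence clause, applied to a
  one-element family.\<close>

lemma (in prob_space) poisson_count_measurable:
  assumes "homogeneous_poisson_process M lam X" "B \<in> sets borel" "bounded B"
  shows "point_count X B \<in> measurable M (count_space UNIV)"
  using poisson_indep_counts[OF assms(1), of "{0}" "\<lambda>_. B"] assms(2,3)
  by (simp add: disjoint_family_on_def indep_vars_def)

lemma poisson_finite_in_bounded:
  assumes "homogeneous_poisson_process M lam X" "bounded B"
  shows "AE w in M. finite {n. X n w \<in> B}"
proof -
  obtain r where r: "\<And>x. x \<in> B \<Longrightarrow> norm x \<le> r" using assms(2) by (auto simp: bounded_iff)
  have "AE w in M. \<forall>r. finite {n. norm (X n w) \<le> r}"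
    using assms(1) by (simp add: homogeneous_poisson_process_def)
  then show ?thesis
    by eventually_elim (erule allE[of _ r], erule rev_finite_subset, use r in auto)
qed

text \<open>Given the positions, the \<open>N\<close> points in \<open>B\<close> all fail to be
  marked with probability \<open>(1 - p * q) ^ N\<close>. Averaging over the Poisson law of
  \<open>N\<close> with mean \<open>m\<close> gives
  \<open>exp (m * (1 - p * q)) * exp (- m)\<close>.\<close>

lemma (in prob_space) poisson_thinned_void_prob:
  assumes X: "homogeneous_poisson_process M lam X"
    and marks: "independent_marks M X A F p q" and B: "B \<in> sets borel" "bounded B"
  shows "measure M {w \<in> space M. \<forall>n. X n w \<in> B \<longrightarrow> \<not> (A n w \<and> F n w)}
    = exp (- (lam * p * q * measure lborel B))" (is "measure M ?V = _")
proof -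
  define m where "m = lam * measure lborel B"
  have ind: "indep_vars (\<lambda>_. count_space UNIV) (\<lambda>s w. marks A F w s) UNIV"
    and p: "\<And>n. prob {w \<in> space M. A n w} = p" and q: "\<And>n. prob {w \<in> space M. F n w} = q"
    and indX: "indep_rv M (PiM UNIV (\<lambda>_. borel)) (\<lambda>w n. X n w) (PiM UNIV (\<lambda>_. count_space UNIV)) (marks A F)"
    using marks by (auto simp: independent_marks_def)
  \<comment> \<open>\<open>p\<close> and \<open>q\<close> are arbitrary reals here; that
    \<open>p * q \<le> 1\<close> is read off from the probability that point 0 is not
    marked.\<close>
  have pq: "0 \<le> 1 - p * q"
  proof -
    have "prob {w \<in> space M. \<forall>n\<in>{0}. \<not> (A n w \<and> F n w)} = (1 - p * q) ^ card {0::nat}"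
      by (rule prob_no_marked_point[OF ind p q]) simp
    then have "1 - p * q = prob {w \<in> space M. \<forall>n\<in>{0}. \<not> (A n w \<and> F n w)}" by simp
    then show ?thesis by (simp only: measure_nonneg)
  qed
  have count: "prob {w \<in> space M. point_count X B w = j} = m ^ j / fact j * exp (- m)" for j
    using X B by (simp add: homogeneous_poisson_process_def m_def)
  define Q where "Q = {z \<in> space (PiM UNIV (\<lambda>_. borel) \<Otimes>\<^sub>M PiM UNIV (\<lambda>_. count_space UNIV)).
    \<forall>n::nat. fst z n \<in> B \<longrightarrow> \<not> (snd z (Inl n) \<and> snd z (Inr n))}"
  have Q: "Q \<in> sets (PiM (UNIV :: nat set) (\<lambda>_. borel :: complex measure) \<Otimes>\<^sub>M PiM (UNIV :: (nat + nat) set) (\<lambda>_. count_space (UNIV :: bool set)))"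
    unfolding Q_def using B(1) by measurable
  have "emeasure M ?V = emeasure M {w \<in> space M. ((\<lambda>n. X n w), marks A F w) \<in> Q}"
    by (auto simp: Q_def space_pair_measure space_PiM marks_def intro!: arg_cong[where f="emeasure M"])
  also have "\<dots> = (\<integral>\<^sup>+w. emeasure M {w' \<in> space M. ((\<lambda>n. X n w), marks A F w') \<in> Q} \<partial>M)"
    by (rule emeasure_indep_rv(1)[OF indX Q])
  also have "\<dots> = (\<integral>\<^sup>+w. ennreal ((1 - p * q) ^ point_count X B w) \<partial>M)"
  proof (rule nn_integral_cong_AE)
    show "AE w in M. emeasure M {w' \<in> space M. ((\<lambda>n. X n w), marks A F w') \<in> Q} = ennreal ((1 - p * q) ^ point_count X B w)"
      using poisson_finite_in_bounded[OF X B(2)]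
    proof eventually_elim
      fix w assume "finite {n. X n w \<in> B}"
      from prob_no_marked_point[OF ind p q this]
      show "emeasure M {w' \<in> space M. ((\<lambda>n. X n w), marks A F w') \<in> Q} = ennreal ((1 - p * q) ^ point_count X B w)"
        by (simp add: Q_def space_pair_measure space_PiM marks_def emeasure_eq_measure point_count_def)
    qed
  qed
  \<comment> \<open>The integrand is split by the value of the count; for each \<open>w\<close>
    exactly one term of the series survives.\<close>
  also have "\<dots> = (\<integral>\<^sup>+w. (\<Sum>j. ennreal ((1 - p * q) ^ j) * indicator {w \<in> space M. point_count X B w = j} w) \<partial>M)"
  proof (rule nn_integral_cong)
    fix w assume "w \<in> space M"
    then have "(\<Sum>j. ennreal ((1 - p * q) ^ j) * indicator {w \<in> space M. point_count X B w = j} w)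
       = (\<Sum>j\<in>{point_count X B w}. ennreal ((1 - p * q) ^ j) * indicator {w \<in> space M. point_count X B w = j} w)"
      by (intro suminf_finite) auto
    also have "\<dots> = ennreal ((1 - p * q) ^ point_count X B w)"
      using \<open>w \<in> space M\<close> by simp
    finally show "ennreal ((1 - p * q) ^ point_count X B w)
       = (\<Sum>j. ennreal ((1 - p * q) ^ j) * indicator {w \<in> space M. point_count X B w = j} w)" ..
  qed
  also have "\<dots> = (\<Sum>j. ennreal ((1 - p * q) ^ j) * emeasure M {w \<in> space M. point_count X B w = j})"
  proof -
    have [measurable]: "point_count X B \<in> measurable M (count_space UNIV)"
      by (rule poisson_count_measurable[OF X B])
    show ?thesis
      by (subst nn_integral_suminf) (auto simp: nn_integral_cmult)
  qed
  also have "\<dots> = (\<Sum>j. ennreal ((1 - p * q) ^ j * (m ^ j / fact j * exp (- m))))"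
    by (intro suminf_cong) (simp only: emeasure_eq_measure count ennreal_mult' zero_le_power pq)
  also have "\<dots> = ennreal (exp (m * (1 - p * q)) * exp (- m))"
  proof (rule suminf_ennreal_eq)
    show "0 \<le> (1 - p * q) ^ j * (m ^ j / fact j * exp (- m))" for j
      unfolding count[symmetric] using pq by simp
    have "(\<lambda>j. (m * (1 - p * q)) ^ j / fact j * exp (- m)) sums (exp (m * (1 - p * q)) * exp (- m))"
      using exp_converges[of "m * (1 - p * q)"] by (intro sums_mult2) (simp add: field_simps)
    then show "(\<lambda>j. (1 - p * q) ^ j * (m ^ j / fact j * exp (- m))) sums (exp (m * (1 - p * q)) * exp (- m))"
      by (simp add: power_mult_distrib mult_ac)
  qed
  also have "exp (m * (1 - p * q)) * exp (- m) = exp (- (lam * p * q * measure lborel B))"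
    by (simp add: m_def algebra_simps flip: exp_add)
  finally show ?thesis by (simp add: emeasure_eq_measure)
qed

text \<open>Once the obstacles are frozen at \<open>y\<close>, the section of \<open>R\<close> at
  \<open>y\<close> is a fixed bounded Borel set, so the void probability of the thinned process
  applies. \<open>E\<close> carries an additional condition on the obstacles alone, which is later
  the established link.\<close>

lemma blockage_model_void_prob:
  fixes M :: "'w measure"
  assumes model: "blockage_interference_model M X A F Y lam_t lam_o rho_a \<theta>"
    and E [measurable]: "E \<in> sets (PiM UNIV (\<lambda>_::nat. borel :: complex measure))"
    and R [measurable]: "R \<in> sets (PiM UNIV (\<lambda>_::nat. borel :: complex measure) \<Otimes>\<^sub>M (borel :: complex measure))"
    and bnd: "\<And>y. bounded (Pair y -` R)"
  shows "emeasure M {w \<in> space M. (\<lambda>m. Y m w) \<in> E \<and> (\<forall>n. ((\<lambda>m. Y m w), X n w) \<in> R \<longrightarrow> \<not> (A n w \<and> F n w))}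
    = (\<integral>\<^sup>+w. ennreal (exp (- (lam_t * rho_a * (\<theta> / (2 * pi)) * measure lborel (Pair (\<lambda>m. Y m w) -` R))))
         * indicator E (\<lambda>m. Y m w) \<partial>M)"
    (is "emeasure M ?V = _")
proof -
  let ?NX = "PiM UNIV (\<lambda>_::nat. borel :: complex measure)"
  let ?NF = "PiM UNIV (\<lambda>_::nat + nat. count_space (UNIV :: bool set))"
  interpret prob_space M using model by (simp add: blockage_interference_model_def)
  have X: "homogeneous_poisson_process M lam_t X"
    and marks: "independent_marks M X A F rho_a (\<theta> / (2 * pi))"
    and ind: "indep_rv M (?NX \<Otimes>\<^sub>M ?NF) (\<lambda>w. (\<lambda>n. X n w, marks A F w)) ?NX (\<lambda>w n. Y n w)"
    using model by (auto simp: blockage_interference_model_def)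
  define Q where "Q = {z \<in> space ((?NX \<Otimes>\<^sub>M ?NF) \<Otimes>\<^sub>M ?NX).
    snd z \<in> E \<and> (\<forall>n. (snd z, fst (fst z) n) \<in> R \<longrightarrow> \<not> (snd (fst z) (Inl n) \<and> snd (fst z) (Inr n)))}"
  have Q: "Q \<in> sets ((?NX \<Otimes>\<^sub>M ?NF) \<Otimes>\<^sub>M ?NX)"
    unfolding Q_def by measurable
  have sec: "Pair y -` R \<in> sets borel" for y using R by (rule sets_Pair1)
  have "emeasure M ?V = emeasure M {w \<in> space M. ((\<lambda>n. X n w, marks A F w), \<lambda>n. Y n w) \<in> Q}"
    by (auto simp: Q_def space_pair_measure space_PiM marks_def intro!: arg_cong[where f="emeasure M"])
  also have "\<dots> = (\<integral>\<^sup>+w. emeasure M {w' \<in> space M. ((\<lambda>n. X n w', marks A F w'), \<lambda>n. Y n w) \<in> Q} \<partial>M)"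
    by (rule emeasure_indep_rv(2)[OF ind Q])
  also have "\<dots> = (\<integral>\<^sup>+w. ennreal (exp (- (lam_t * rho_a * (\<theta> / (2 * pi)) * measure lborel (Pair (\<lambda>m. Y m w) -` R))))
         * indicator E (\<lambda>m. Y m w) \<partial>M)"
  proof (rule nn_integral_cong)
    fix w
    show "emeasure M {w' \<in> space M. ((\<lambda>n. X n w', marks A F w'), \<lambda>n. Y n w) \<in> Q}
      = ennreal (exp (- (lam_t * rho_a * (\<theta> / (2 * pi)) * measure lborel (Pair (\<lambda>m. Y m w) -` R)))) * indicator E (\<lambda>m. Y m w)"
      using poisson_thinned_void_prob[OF X marks sec bnd, of "\<lambda>m. Y m w"]
      by (cases "(\<lambda>m. Y m w) \<in> E")
         (simp_all add: Q_def space_pair_measure space_PiM marks_def emeasure_eq_measure)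
  qed
  finally show ?thesis .
qed

section \<open>Nearest obstacles\<close>

text \<open>Capping at \<open>d\<close> keeps the nearest distance finite when \<open>y\<close> misses \<open>S\<close>.\<close>

definition nearest :: "real \<Rightarrow> complex set \<Rightarrow> (nat \<Rightarrow> complex) \<Rightarrow> real" where
  "nearest d S y = (INF m. if y m \<in> S then min (norm (y m)) d else d)"

lemma nearest_measurable [measurable (raw)]:
  assumes S: "S \<in> sets borel" and Y [measurable]: "\<And>m. (\<lambda>w. Y w m) \<in> borel_measurable M"
  shows "(\<lambda>w. nearest d S (Y w)) \<in> borel_measurable M"
proof -
  have [measurable]: "S \<in> sets borel" by (rule S)
  show ?thesis unfolding nearest_def by measurable
qed

lemma bdd_below_nearest: "bdd_below (range (\<lambda>m. if y m \<in> S then min (norm (y m)) d else d))"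
  by (rule bdd_belowI[of _ "min 0 d"]) (auto simp: min_le_iff_disj)

lemma nearest_le: "nearest d S y \<le> d"
  unfolding nearest_def by (rule cINF_lower2[OF bdd_below_nearest, of undefined]) auto

lemma le_nearest_iff:
  assumes "r \<le> d"
  shows "r \<le> nearest d S y \<longleftrightarrow> (\<forall>m. y m \<in> S \<longrightarrow> r \<le> norm (y m))"
  unfolding nearest_def using assms by (subst le_cINF_iff[OF _ bdd_below_nearest]) auto

lemma nearest_nonneg: "0 \<le> d \<Longrightarrow> 0 \<le> nearest d S y"
  by (simp add: le_nearest_iff)

text \<open>A count of 0 means either no point or infinitely many, since \<open>card\<close> is 0 on
  infinite sets; the second case has probability zero because \<open>B\<close> is bounded.\<close>

lemma (in prob_space) poisson_void_prob:
  assumes "homogeneous_poisson_process M lam Y" "B \<in> sets borel" "bounded B"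
  shows "measure M {w \<in> space M. \<forall>m. Y m w \<notin> B} = exp (- (lam * measure lborel B))"
    and "AE w in M. (\<forall>m. Y m w \<notin> B) \<longleftrightarrow> point_count Y B w = 0"
proof -
  have [measurable]: "point_count Y B \<in> measurable M (count_space UNIV)"
    by (rule poisson_count_measurable[OF assms])
  have [measurable]: "Y m \<in> borel_measurable M" for m
    using assms(1) by (simp add: homogeneous_poisson_process_def)
  note [measurable] = \<open>B \<in> sets borel\<close>
  show AE: "AE w in M. (\<forall>m. Y m w \<notin> B) \<longleftrightarrow> point_count Y B w = 0"
    using poisson_finite_in_bounded[OF assms(1,3)]
    by eventually_elim (auto simp: point_count_def)
  have "prob {w \<in> space M. \<forall>m. Y m w \<notin> B} = prob {w \<in> space M. point_count Y B w = 0}"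
    using AE by (intro finite_measure_eq_AE) auto
  also have "\<dots> = exp (- (lam * measure lborel B))"
    using assms by (simp add: homogeneous_poisson_process_def)
  finally show "prob {w \<in> space M. \<forall>m. Y m w \<notin> B} = exp (- (lam * measure lborel B))" .
qed

lemma le_nearest_iff_void:
  assumes "r \<le> d"
  shows "r \<le> nearest d S y \<longleftrightarrow> (\<forall>m. y m \<notin> S \<inter> ball 0 r)"
  using assms by (auto simp: le_nearest_iff)

lemma (in prob_space) poisson_prob_le_nearest:
  assumes "homogeneous_poisson_process M lam Y" "S \<in> sets borel" "r \<le> d"
  shows "measure M {w \<in> space M. r \<le> nearest d S (\<lambda>m. Y m w)} = exp (- (lam * measure lborel (S \<inter> ball 0 r)))"
  unfolding le_nearest_iff_void[OF assms(3)]
  using assms by (intro poisson_void_prob) (auto simp: bounded_Int)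

text \<open>Tail events of the distances are void events of the disjoint bounded sets
  \<open>S i \<inter> ball 0 (r i)\<close>, whose counts are independent. Upper half-lines generate
  the Borel sets and are stable under intersection, so product formulas for tails suffice.\<close>

lemma (in prob_space) poisson_indep_nearest:
  assumes Y: "homogeneous_poisson_process M lam Y"
    and I: "finite I" "I \<noteq> {}" and S: "\<And>i. i \<in> I \<Longrightarrow> S i \<in> sets borel"
    and disj: "disjoint_family_on S I" and "0 \<le> d"
  shows "indep_vars (\<lambda>_. borel) (\<lambda>i w. nearest d (S i) (\<lambda>m. Y m w)) (I :: nat set)"
proof -
  have Ym [measurable]: "Y m \<in> borel_measurable M" for m
    using Y by (simp add: homogeneous_poisson_process_def)
  define D where "D i w = nearest d (S i) (\<lambda>m. Y m w)" for i w
  have D [measurable]: "D i \<in> borel_measurable M" if "i \<in> I" for i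
    unfolding D_def using S[OF that] by measurable
  have tail: "prob (\<Inter>i\<in>I. {w \<in> space M. r i \<le> D i w}) = (\<Prod>i\<in>I. prob {w \<in> space M. r i \<le> D i w})" for r
  proof (cases "\<forall>i\<in>I. r i \<le> d")
    \<comment> \<open>A threshold above the cap \<open>d\<close> is never reached, so both sides
      vanish.\<close>
    case False
    then obtain i where i: "i \<in> I" "d < r i" by (auto simp: not_le)
    then have "{w \<in> space M. r i \<le> D i w} = {}"
      using nearest_le[of d "S i"] by (auto simp: D_def not_le intro: le_less_trans)
    then have "prob {w \<in> space M. r i \<le> D i w} = 0" by (simp only: measure_empty)
    then have "(\<Prod>i\<in>I. prob {w \<in> space M. r i \<le> D i w}) = 0"
      using i(1) I(1) by (intro prod_zero bexI[of _ i])
    moreover have "(\<Inter>i\<in>I. {w \<in> space M. r i \<le> D i w}) = {}"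
      using i(1) \<open>{w \<in> space M. r i \<le> D i w} = {}\<close> by blast
    ultimately show ?thesis by simp
  next
    case True
    define B where "B i = S i \<inter> ball 0 (r i)" for i
    have B: "B i \<in> sets borel" "bounded (B i)" if "i \<in> I" for i
      using S[OF that] by (auto simp: B_def bounded_Int)
    have iff: "AE w in M. r i \<le> D i w \<longleftrightarrow> point_count Y (B i) w = 0" if "i \<in> I" for i
    proof -
      have "r i \<le> D i w \<longleftrightarrow> (\<forall>m. Y m w \<notin> B i)" for w
        unfolding D_def B_def using True that by (intro le_nearest_iff_void) auto
      then show ?thesis using poisson_void_prob(2)[OF Y B[OF that]] by (simp only:)
    qed
    have pc [measurable]: "point_count Y (B i) \<in> measurable M (count_space UNIV)" if "i \<in> I" for i
      by (rule poisson_count_measurable[OF Y B[OF that]])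
    have ind: "indep_vars (\<lambda>_. count_space UNIV) (\<lambda>i. point_count Y (B i)) I"
      using disj B by (intro poisson_indep_counts[OF Y I(1)]) (auto simp: disjoint_family_on_def B_def)
    have "prob (\<Inter>i\<in>I. {w \<in> space M. r i \<le> D i w}) = prob (\<Inter>i\<in>I. point_count Y (B i) -` {0} \<inter> space M)"
    proof (rule finite_measure_eq_AE)
      have "AE w in M. \<forall>i\<in>I. r i \<le> D i w \<longleftrightarrow> point_count Y (B i) w = 0"
        using iff I(1) by (simp add: AE_finite_all)
      then show "AE w in M. (w \<in> (\<Inter>i\<in>I. {w \<in> space M. r i \<le> D i w})) = (w \<in> (\<Inter>i\<in>I. point_count Y (B i) -` {0} \<inter> space M))"
        using AE_space by eventually_elim auto
      show "(\<Inter>i\<in>I. {w \<in> space M. r i \<le> D i w}) \<in> events"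
        by (rule sets.finite_INT[OF I]) measurable
      show "(\<Inter>i\<in>I. point_count Y (B i) -` {0} \<inter> space M) \<in> events"
        by (rule sets.finite_INT[OF I], rule measurable_sets[OF pc]) auto
    qed
    also have "\<dots> = (\<Prod>i\<in>I. prob (point_count Y (B i) -` {0} \<inter> space M))"
      by (rule indep_varsD[OF ind I(2,1)]) auto
    also have "\<dots> = (\<Prod>i\<in>I. prob {w \<in> space M. r i \<le> D i w})"
    proof (rule prod.cong[OF refl], rule finite_measure_eq_AE)
      fix i assume i: "i \<in> I"
      show "AE w in M. (w \<in> point_count Y (B i) -` {0} \<inter> space M) = (w \<in> {w \<in> space M. r i \<le> D i w})"
        using iff[OF i] AE_space by eventually_elim auto
      show "point_count Y (B i) -` {0} \<inter> space M \<in> events" by (rule measurable_sets[OF pc[OF i]]) simp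
      show "{w \<in> space M. r i \<le> D i w} \<in> events" using i by measurable
    qed
    finally show ?thesis .
  qed
  \<comment> \<open>The generator has to contain the whole space. Its preimage is again a tail
    event, with threshold 0, because the distances are nonnegative.\<close>
  let ?E = "insert UNIV (range (\<lambda>r::real. {r..}))"
  have "indep_vars (\<lambda>_. borel) D I"
  proof (subst indep_vars_finite[OF I(2,1), where E="\<lambda>_. ?E"])
    have "sigma_sets UNIV ?E = sigma_sets UNIV (range (\<lambda>r::real. {r..}))"
      by (rule sigma_sets_eqI) (auto intro: sigma_sets_top sigma_sets.Basic)
    then show "sets borel = sigma_sets (space borel) ?E"
      by (subst borel_Ici) simp
    have "{a..} \<inter> {b..} = {max a b..}" for a b :: real by auto
    then show "Int_stable ?E"
      by (auto simp: Int_stable_def)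
    show "\<forall>A\<in>I \<rightarrow> ?E. prob (\<Inter>j\<in>I. D j -` A j \<inter> space M) = (\<Prod>j\<in>I. prob (D j -` A j \<inter> space M))"
    proof
      fix A assume A: "A \<in> I \<rightarrow> ?E"
      have "\<exists>r. D i -` A i \<inter> space M = {w \<in> space M. r \<le> D i w}" if "i \<in> I" for i
      proof (cases "A i = UNIV")
        case True
        then show ?thesis
          using nearest_nonneg[OF \<open>0 \<le> d\<close>] by (intro exI[of _ 0]) (auto simp: D_def)
      next
        case False
        with A that obtain r where "A i = {r..}" by (auto simp: Pi_iff)
        then show ?thesis by (intro exI[of _ r]) auto
      qed
      then obtain r where r: "\<And>i. i \<in> I \<Longrightarrow> D i -` A i \<inter> space M = {w \<in> space M. r i \<le> D i w}"
        by metis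
      show "prob (\<Inter>j\<in>I. D j -` A j \<inter> space M) = (\<Prod>j\<in>I. prob (D j -` A j \<inter> space M))"
        using tail[of r] by (simp add: r cong: prod.cong INF_cong_simp)
    qed
  qed (auto intro: D)
  then show ?thesis unfolding D_def .
qed

text \<open>The law of \<open>D\<close> is of Rayleigh type below \<open>d\<close> and has an atom
  of mass \<open>exp (- (b * d\<^sup>2))\<close> at the cap \<open>d\<close>. A computation from
  tails treats both parts at once and needs no density of \<open>D\<close>.\<close>

lemma (in prob_space) nn_integral_exp_rayleigh_tail:
  fixes D :: "'a \<Rightarrow> real"
  assumes D [measurable]: "D \<in> borel_measurable M" and D_bounds: "\<And>w. 0 \<le> D w" "\<And>w. D w \<le> d"
    and tail: "\<And>r. 0 \<le> r \<Longrightarrow> r \<le> d \<Longrightarrow> prob {w \<in> space M. r \<le> D w} = exp (- (b * r\<^sup>2))"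
    and bc: "0 < b" "0 < c" and l: "0 \<le> l" "l \<le> d"
  shows "(\<integral>\<^sup>+w. ennreal (exp (- (c * (D w)\<^sup>2))) * indicator {l..} (D w) \<partial>M)
    = ennreal (exp (- ((b + c) * l\<^sup>2)) - c / (b + c) * (exp (- ((b + c) * l\<^sup>2)) - exp (- ((b + c) * d\<^sup>2))))"
proof -
  interpret MS: pair_sigma_finite M lborel ..
  define f where "f s = 2 * c * s * exp (- (c * s\<^sup>2))" for s :: real
  have [measurable]: "f \<in> borel_measurable borel" unfolding f_def by measurable
  have f_nonneg: "0 \<le> f s" if "0 \<le> s" for s using that bc by (simp add: f_def)
  \<comment> \<open>writing \<open>exp (- c * D\<^sup>2)\<close> as an integral over levels leaves only tail probabilities of \<open>D\<close>\<close>
  have layer: "ennreal (exp (- (c * (D w)\<^sup>2))) * indicator {l..} (D w)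
     = ennreal (exp (- (c * d\<^sup>2))) * indicator {l..} (D w)
       + (\<integral>\<^sup>+s. (if l \<le> D w \<and> D w < s \<and> s \<le> d then ennreal (f s) else 0) \<partial>lborel)" for w
  proof (cases "l \<le> D w")
    case True
    \<comment> \<open>The strict bound \<open>D w < s\<close> is chosen so that, for fixed
      \<open>s\<close>, the event is a difference of two tail events; closing the interval at
      \<open>D w\<close> adds only a null set.\<close>
    have "(\<integral>\<^sup>+s. (if l \<le> D w \<and> D w < s \<and> s \<le> d then ennreal (f s) else 0) \<partial>lborel)
        = (\<integral>\<^sup>+s. ennreal (f s) * indicator {D w..d} s \<partial>lborel)"
      using True by (intro nn_integral_cong_AE eventually_mono[OF AE_lborel_singleton[of "D w"]])
        (auto simp: indicator_def)
    also have "\<dots> = ennreal (- exp (- (c * d\<^sup>2)) - - exp (- (c * (D w)\<^sup>2)))"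
    proof (rule nn_integral_FTC_Icc)
      fix s assume "s \<in> {D w..d}"
      then show "0 \<le> f s" using D_bounds(1)[of w] by (intro f_nonneg) auto
      show "DERIV (\<lambda>s. - exp (- (c * s\<^sup>2))) s :> f s"
        unfolding f_def by (auto intro!: derivative_eq_intros)
    qed (use D_bounds(2) in auto)
    finally have eq: "(\<integral>\<^sup>+s. (if l \<le> D w \<and> D w < s \<and> s \<le> d then ennreal (f s) else 0) \<partial>lborel)
        = ennreal (exp (- (c * (D w)\<^sup>2)) - exp (- (c * d\<^sup>2)))" by simp
    have "c * (D w)\<^sup>2 \<le> c * d\<^sup>2"
      using D_bounds[of w] bc by (intro mult_left_mono power_mono) auto
    then have "ennreal (exp (- (c * d\<^sup>2))) + ennreal (exp (- (c * (D w)\<^sup>2)) - exp (- (c * d\<^sup>2)))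
        = ennreal (exp (- (c * (D w)\<^sup>2)))"
      by (subst ennreal_plus[symmetric]) auto
    with True eq show ?thesis by simp
  qed simp
  have int: "(\<integral>\<^sup>+w. (if l \<le> D w \<and> D w < s \<and> s \<le> d then ennreal (f s) else 0) \<partial>M)
     = ennreal (f s * (exp (- (b * l\<^sup>2)) - exp (- (b * s\<^sup>2)))) * indicator {l..d} s" for s
  proof (cases "s \<in> {l..d}")
    case True
    have "(\<integral>\<^sup>+w. (if l \<le> D w \<and> D w < s \<and> s \<le> d then ennreal (f s) else 0) \<partial>M)
       = (\<integral>\<^sup>+w. ennreal (f s) * indicator {w \<in> space M. l \<le> D w \<and> D w < s} w \<partial>M)"
      using True by (intro nn_integral_cong) auto
    also have "\<dots> = ennreal (f s) * ennreal (prob {w \<in> space M. l \<le> D w \<and> D w < s})"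
      by (subst nn_integral_cmult) (auto simp: emeasure_eq_measure)
    also have "{w \<in> space M. l \<le> D w \<and> D w < s} = {w \<in> space M. l \<le> D w} - {w \<in> space M. s \<le> D w}"
      by auto
    also have "prob \<dots> = exp (- (b * l\<^sup>2)) - exp (- (b * s\<^sup>2))"
      using True l by (subst finite_measure_Diff) (auto simp: tail)
    finally show ?thesis using True l f_nonneg[of s] by (simp add: ennreal_mult')
  next
    case False
    then have "(\<integral>\<^sup>+w. (if l \<le> D w \<and> D w < s \<and> s \<le> d then ennreal (f s) else 0) \<partial>M) = (\<integral>\<^sup>+w. 0 \<partial>M)"
      by (intro nn_integral_cong) auto
    with False show ?thesis by simp
  qed
  have mono: "b * l\<^sup>2 \<le> b * s\<^sup>2" if "l \<le> s" for s using that l bc by (simp add: power_mono)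
  \<comment> \<open>An antiderivative of \<open>f s\<close> times the probability of
    \<open>l \<le> D w \<and> D w < s\<close>. The first term integrates the constant
    \<open>exp (- (b * l\<^sup>2))\<close>, the second the product of the two Gaussian
    factors.\<close>
  define H where "H s = - exp (- (b * l\<^sup>2)) * exp (- (c * s\<^sup>2)) + c / (b + c) * exp (- ((b + c) * s\<^sup>2))" for s
  have dH: "DERIV H s :> f s * (exp (- (b * l\<^sup>2)) - exp (- (b * s\<^sup>2)))" for s
  proof -
    have "DERIV H s :> - exp (- (b * l\<^sup>2)) * (exp (- (c * s\<^sup>2)) * - (c * (2 * s)))
        + c / (b + c) * (exp (- ((b + c) * s\<^sup>2)) * - ((b + c) * (2 * s)))"
      unfolding H_def by (auto intro!: derivative_eq_intros)
    also have "c / (b + c) * (exp (- ((b + c) * s\<^sup>2)) * - ((b + c) * (2 * s)))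
        = - (2 * c * s * (exp (- (b * s\<^sup>2)) * exp (- (c * s\<^sup>2))))"
    proof -
      have "exp (- ((b + c) * s\<^sup>2)) = exp (- (b * s\<^sup>2)) * exp (- (c * s\<^sup>2))"
        by (simp add: algebra_simps flip: exp_add)
      moreover have "b + c \<noteq> 0" using bc by simp
      ultimately show ?thesis by simp
    qed
    finally show ?thesis by (simp add: f_def algebra_simps)
  qed
  have nonneg: "0 \<le> f s * (exp (- (b * l\<^sup>2)) - exp (- (b * s\<^sup>2)))" if "l \<le> s" for s
    using that l mono by (intro mult_nonneg_nonneg f_nonneg) auto
  \<comment> \<open>Monotonicity keeps \<open>H d - H l\<close> nonnegative, so that the sum of
    extended nonnegative reals below can be evaluated in the reals.\<close>
  have "H l \<le> H d"
  proof (rule DERIV_nonneg_imp_nondecreasing[OF l(2)])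
    fix s assume "l \<le> s"
    then show "\<exists>y. DERIV H s :> y \<and> 0 \<le> y" using dH[of s] nonneg[of s] by blast
  qed
  have "(\<integral>\<^sup>+w. ennreal (exp (- (c * (D w)\<^sup>2))) * indicator {l..} (D w) \<partial>M)
     = (\<integral>\<^sup>+w. ennreal (exp (- (c * d\<^sup>2))) * indicator {w \<in> space M. l \<le> D w} w
       + (\<integral>\<^sup>+s. (if l \<le> D w \<and> D w < s \<and> s \<le> d then ennreal (f s) else 0) \<partial>lborel) \<partial>M)"
    unfolding layer by (intro nn_integral_cong arg_cong2[where f="(+)"] refl) (simp add: indicator_def)
  also have "\<dots> = ennreal (exp (- (c * d\<^sup>2))) * ennreal (exp (- (b * l\<^sup>2)))
     + (\<integral>\<^sup>+w. \<integral>\<^sup>+s. (if l \<le> D w \<and> D w < s \<and> s \<le> d then ennreal (f s) else 0) \<partial>lborel \<partial>M)"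
    using l by (subst nn_integral_add) (auto simp: nn_integral_cmult emeasure_eq_measure tail)
  also have "(\<integral>\<^sup>+w. \<integral>\<^sup>+s. (if l \<le> D w \<and> D w < s \<and> s \<le> d then ennreal (f s) else 0) \<partial>lborel \<partial>M)
     = (\<integral>\<^sup>+s. \<integral>\<^sup>+w. (if l \<le> D w \<and> D w < s \<and> s \<le> d then ennreal (f s) else 0) \<partial>M \<partial>lborel)"
    by (rule MS.Fubini'[symmetric]) measurable
  also have "\<dots> = ennreal (H d - H l)"
    unfolding int by (rule nn_integral_FTC_Icc[OF _ dH nonneg l(2)]) auto
  also have "ennreal (exp (- (c * d\<^sup>2))) * ennreal (exp (- (b * l\<^sup>2))) + ennreal (H d - H l)
     = ennreal (exp (- (c * d\<^sup>2)) * exp (- (b * l\<^sup>2)) + (H d - H l))"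
    using \<open>H l \<le> H d\<close> by (simp add: ennreal_plus ennreal_mult)
  also have "exp (- (c * d\<^sup>2)) * exp (- (b * l\<^sup>2)) + (H d - H l)
     = exp (- ((b + c) * l\<^sup>2)) - c / (b + c) * (exp (- ((b + c) * l\<^sup>2)) - exp (- ((b + c) * d\<^sup>2)))"
  proof -
    have "exp (- (b * l\<^sup>2)) * exp (- (c * l\<^sup>2)) = exp (- ((b + c) * l\<^sup>2))"
      by (simp add: algebra_simps flip: exp_add)
    then show ?thesis by (simp add: H_def algebra_simps)
  qed
  finally show ?thesis .
qed

section \<open>The collision probability\<close>

locale blockage_setup =
  fixes M :: "'w measure"
    and X Y :: "nat \<Rightarrow> 'w \<Rightarrow> complex" and A F :: "nat \<Rightarrow> 'w \<Rightarrow> bool"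
    and lam_t lam_o rho_a dmax \<theta> \<theta>c \<alpha> :: real
  assumes pos: "0 < lam_t" "0 < lam_o" "0 < rho_a" "0 < dmax" "0 < \<theta>" "0 < \<theta>c"
    and theta_le: "\<theta> \<le> 2 * pi" and integral_ratio: "\<theta> / \<theta>c \<in> \<int>"
    and model: "blockage_interference_model M X A F Y lam_t lam_o rho_a \<theta>"
begin

sublocale prob_space M
  using model by (simp add: blockage_interference_model_def)

definition lam_I :: real where "lam_I = rho_a * lam_t * \<theta> / (2 * pi)"

definition k :: nat where "k = num_sectors \<theta> \<theta>c"

definition D :: "nat \<Rightarrow> 'w \<Rightarrow> real" where
  "D i w = nearest dmax (sector \<alpha> \<theta>c i) (\<lambda>m. Y m w)"

text \<open>\<open>b * r\<^sup>2\<close> and, with the next constant, \<open>c * r\<^sup>2\<close>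
  are the mean numbers of obstacles and of potential interferers of one sector within distance
  \<open>r\<close>.\<close>

definition b :: real where "b = lam_o * \<theta>c / 2"

definition c :: real where "c = lam_I * \<theta>c / 2"

text \<open>For \<open>l\<close> between 0 and \<open>dmax\<close>, this is the expectation of
  \<open>exp (- (c * (D i w)\<^sup>2))\<close> restricted to \<open>l \<le> D i w\<close>, the same
  for every sector.\<close>

definition phi :: "real \<Rightarrow> real" where
  "phi l = exp (- ((b + c) * l\<^sup>2)) - c / (b + c) * (exp (- ((b + c) * l\<^sup>2)) - exp (- ((b + c) * dmax\<^sup>2)))"

lemma lam_I_pos: "0 < lam_I"
  using pos by (simp add: lam_I_def)

lemma bc_pos: "0 < b" "0 < c"
  using pos lam_I_pos by (simp_all add: b_def c_def)

text \<open>Integrality of the ratio makes the ceiling exact, so that the sectors tile the main lobe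
  without exceeding a full turn.\<close>

lemma k_times: "real k * \<theta>c = \<theta>" and k_pos: "1 \<le> k"
proof -
  obtain z where z: "\<theta> / \<theta>c = of_int z" using integral_ratio by (auto elim: Ints_cases)
  moreover have "0 < \<theta> / \<theta>c" using pos by simp
  ultimately have "0 < z" by simp
  then have k: "real k = \<theta> / \<theta>c" by (simp add: k_def num_sectors_def z)
  then show "real k * \<theta>c = \<theta>" using pos by simp
  show "1 \<le> k" using k \<open>0 < \<theta> / \<theta>c\<close> by (cases k) auto
qed

lemma theta_c_le: "\<theta>c \<le> 2 * pi"
proof -
  have "\<theta>c \<le> real k * \<theta>c" using pos k_pos by simp
  with k_times theta_le show ?thesis by simp
qed

lemma sector_borel [measurable]: "sector \<alpha> \<theta>c i \<in> sets borel"
  by (simp add: sector_eq_wedge)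

lemma sectors_disjoint: "disjoint_family_on (sector \<alpha> \<theta>c) {1..k}"
proof -
  have "sector \<alpha> \<theta>c i \<inter> sector \<alpha> \<theta>c j = {}" if "i < j" "1 \<le> i" "j \<le> k" for i j
    unfolding sector_eq_wedge
  proof (rule wedge_disjoint)
    have "real i * \<theta>c \<le> (real j - 1) * \<theta>c" using that pos by (intro mult_right_mono) auto
    then show "\<alpha> + real i * \<theta>c \<le> \<alpha> + (real j - 1) * \<theta>c" by simp
    have "(real j - (real i - 1)) * \<theta>c \<le> real k * \<theta>c"
      using that pos by (intro mult_right_mono) auto
    with k_times theta_le show "\<alpha> + real j * \<theta>c \<le> \<alpha> + (real i - 1) * \<theta>c + 2 * pi"
      by (simp add: algebra_simps)
  qed
  then show ?thesis
    unfolding disjoint_family_on_def by (metis Int_commute atLeastAtMost_iff linorder_neqE_nat)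
qed

lemma measure_sector_between_balls:
  assumes "0 \<le> r" "T \<in> sets borel"
    and "sector \<alpha> \<theta>c i \<inter> ball 0 r \<subseteq> T" "T \<subseteq> sector \<alpha> \<theta>c i \<inter> cball 0 r"
  shows "measure lborel T = \<theta>c * r\<^sup>2 / 2"
proof -
  have "measure lborel T = ((\<alpha> + real i * \<theta>c) - (\<alpha> + (real i - 1) * \<theta>c)) * r\<^sup>2 / 2"
    using assms pos theta_c_le
    by (intro measure_wedge_between_balls) (auto simp: sector_eq_wedge algebra_simps)
  then show ?thesis by (simp add: algebra_simps)
qed

section \<open>Laws of the nearest-obstacle distance and of the link\<close>

lemma obstacles: "homogeneous_poisson_process M lam_o Y"
  using model by (simp add: blockage_interference_model_def)

lemma Y_measurable [measurable]: "Y m \<in> borel_measurable M"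
  using obstacles by (simp add: homogeneous_poisson_process_def)

lemma X_measurable [measurable]: "X n \<in> borel_measurable M"
  using model by (simp add: blockage_interference_model_def homogeneous_poisson_process_def)

lemma marks_measurable [measurable]: "Measurable.pred M (A n)" "Measurable.pred M (F n)"
proof -
  have m: "(\<lambda>w. marks A F w s) \<in> measurable M (count_space UNIV)" for s
    using model by (simp add: blockage_interference_model_def independent_marks_def indep_vars_def)
  show "Measurable.pred M (A n)" "Measurable.pred M (F n)"
    using m[of "Inl n"] m[of "Inr n"] by (simp_all add: marks_def)
qed

lemma D_measurable [measurable]: "D i \<in> borel_measurable M"
  unfolding D_def by measurable

lemma D_bounds: "0 \<le> D i w" "D i w \<le> dmax"
  using pos by (auto simp: D_def nearest_nonneg nearest_le)

lemma prob_le_D: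
  assumes "0 \<le> r" "r \<le> dmax"
  shows "prob {w \<in> space M. r \<le> D i w} = exp (- (b * r\<^sup>2))"
proof -
  have "measure lborel (sector \<alpha> \<theta>c i \<inter> ball 0 r) = \<theta>c * r\<^sup>2 / 2"
    by (rule measure_sector_between_balls) (use assms in auto)
  then show ?thesis
    unfolding D_def using assms
    by (subst poisson_prob_le_nearest[OF obstacles]) (auto simp: b_def)
qed

lemma link_established_iff:
  "link_established \<alpha> \<theta> \<theta>c Y l w \<longleftrightarrow> (\<forall>m. Y m w \<in> sector \<alpha> \<theta>c k \<longrightarrow> l < norm (Y m w))"
  by (auto simp: link_established_def line_of_sight_def k_def not_le)

lemma link_established_measurable [measurable]:
  "Measurable.pred M (link_established \<alpha> \<theta> \<theta>c Y l)"
  unfolding link_established_iff[abs_def] by measurable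

text \<open>An obstacle at distance exactly \<open>l\<close> breaks the link but still allows
  \<open>l \<le> D k w\<close>. The circle of radius \<open>l\<close> is null, so almost surely it
  contains no obstacle.\<close>

lemma AE_link_established_iff:
  assumes "l \<le> dmax"
  shows "AE w in M. link_established \<alpha> \<theta> \<theta>c Y l w \<longleftrightarrow> l \<le> D k w"
proof -
  have "prob {w \<in> space M. \<forall>m. Y m w \<notin> sphere 0 l} = 1"
    using poisson_void_prob(1)[OF obstacles, of "sphere 0 l"] sphere_null_sets_lborel[of 0 l]
    by (simp add: borel_closed measure_eq_0_null_sets)
  then have "AE w in M. w \<in> {w \<in> space M. \<forall>m. Y m w \<notin> sphere 0 l}"
    by (rule AE_prob_1)
  then show ?thesis
    by eventually_elim
      (auto simp: link_established_iff D_def le_nearest_iff[OF assms] order_less_le)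
qed

lemma prob_link_established:
  assumes "0 \<le> l" "l \<le> dmax"
  shows "prob {w \<in> space M. link_established \<alpha> \<theta> \<theta>c Y l w} = exp (- (b * l\<^sup>2))"
proof -
  have "prob {w \<in> space M. link_established \<alpha> \<theta> \<theta>c Y l w} = prob {w \<in> space M. l \<le> D k w}"
    using AE_link_established_iff[OF assms(2)] by (intro finite_measure_eq_AE) auto
  with prob_le_D[OF assms] show ?thesis by simp
qed

text \<open>Defined for a fixed configuration \<open>y\<close>, so that it can be a section of a
  measurable set of pairs. The obstacle bound is strict because an obstacle at equal distance
  already blocks.\<close>

definition los_region :: "nat \<Rightarrow> (nat \<Rightarrow> complex) \<Rightarrow> complex set" where
  "los_region i y = {x. x \<in> sector \<alpha> \<theta>c i \<and> norm x \<le> dmax \<and> (\<forall>m. y m \<in> sector \<alpha> \<theta>c i \<longrightarrow> norm x < norm (y m))}"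

lemma los_region_borel [measurable]: "los_region i y \<in> sets borel"
proof -
  have "Measurable.pred borel (\<lambda>x. x \<in> sector \<alpha> \<theta>c i \<and> norm x \<le> dmax \<and> (\<forall>m. y m \<in> sector \<alpha> \<theta>c i \<longrightarrow> norm x < norm (y m)))"
    by measurable
  then show ?thesis unfolding los_region_def by (simp add: pred_def)
qed

lemma los_region_bounded: "bounded (los_region i y)"
  by (rule bounded_subset[OF bounded_cball[of 0 dmax]]) (auto simp: los_region_def)

lemma measure_los_regions:
  "measure lborel (\<Union>i\<in>{1..k}. los_region i (\<lambda>m. Y m w)) = (\<Sum>i\<in>{1..k}. \<theta>c * (D i w)\<^sup>2 / 2)"
proof -
  have "measure lborel (\<Union>i\<in>{1..k}. los_region i (\<lambda>m. Y m w)) = (\<Sum>i\<in>{1..k}. measure lborel (los_region i (\<lambda>m. Y m w)))"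
  proof (rule measure_finite_Union)
    show "disjoint_family_on (\<lambda>i. los_region i (\<lambda>m. Y m w)) {1..k}"
      using sectors_disjoint unfolding disjoint_family_on_def los_region_def by blast
    show "emeasure lborel (los_region i (\<lambda>m. Y m w)) \<noteq> \<infinity>" if "i \<in> {1..k}" for i
      using emeasure_bounded_finite[OF los_region_bounded[of i "\<lambda>m. Y m w"]] by simp
  qed auto
  also have "\<dots> = (\<Sum>i\<in>{1..k}. \<theta>c * (D i w)\<^sup>2 / 2)"
  proof (rule sum.cong[OF refl], rule measure_sector_between_balls)
    fix i
    show "sector \<alpha> \<theta>c i \<inter> ball 0 (D i w) \<subseteq> los_region i (\<lambda>m. Y m w)"
    proof
      fix x assume x: "x \<in> sector \<alpha> \<theta>c i \<inter> ball 0 (D i w)"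
      have "\<forall>m. Y m w \<in> sector \<alpha> \<theta>c i \<longrightarrow> D i w \<le> norm (Y m w)"
        using le_nearest_iff[OF D_bounds(2), of i w "sector \<alpha> \<theta>c i" "\<lambda>m. Y m w"] by (simp add: D_def)
      with x D_bounds(2)[of i w] show "x \<in> los_region i (\<lambda>m. Y m w)"
        by (auto simp: los_region_def intro: less_le_trans less_imp_le)
    qed
    show "los_region i (\<lambda>m. Y m w) \<subseteq> sector \<alpha> \<theta>c i \<inter> cball 0 (D i w)"
      by (auto simp: los_region_def D_def le_nearest_iff less_imp_le)
  qed (auto simp: D_bounds)
  finally show ?thesis .
qed

text \<open>A collision is thus a hit of the thinned transmitters on a region determined by the
  obstacles alone.\<close>

lemma collision_iff:
  "collision \<alpha> \<theta> \<theta>c dmax X A F Y w \<longleftrightarrow>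
    (\<exists>n. X n w \<in> (\<Union>i\<in>{1..k}. los_region i (\<lambda>m. Y m w)) \<and> A n w \<and> F n w)"
  unfolding collision_def line_of_sight_def k_def los_region_def by (auto simp: not_le)

lemma collision_measurable [measurable]:
  "Measurable.pred M (collision \<alpha> \<theta> \<theta>c dmax X A F Y)"
  unfolding collision_def[abs_def] line_of_sight_def by measurable

text \<open>\<open>phi l\<close> is a convex combination of two exponentials, with weight
  \<open>c / (b + c)\<close> on the second.\<close>

lemma phi_nonneg: "0 \<le> phi l"
proof -
  have "phi l = (1 - c / (b + c)) * exp (- ((b + c) * l\<^sup>2)) + c / (b + c) * exp (- ((b + c) * dmax\<^sup>2))"
    by (simp add: phi_def left_diff_distrib right_diff_distrib)
  moreover have "0 \<le> 1 - c / (b + c)" "0 \<le> c / (b + c)" using bc_pos by simp_all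
  ultimately show ?thesis by (auto intro!: add_nonneg_nonneg mult_nonneg_nonneg simp del: times_divide_eq_left)
qed

lemma emeasure_link_no_collision:
  "emeasure M {w \<in> space M. link_established \<alpha> \<theta> \<theta>c Y l w \<and> \<not> collision \<alpha> \<theta> \<theta>c dmax X A F Y w}
    = (\<integral>\<^sup>+w. ennreal (exp (- (\<Sum>i\<in>{1..k}. c * (D i w)\<^sup>2))) * indicator {w. link_established \<alpha> \<theta> \<theta>c Y l w} w \<partial>M)"
proof -
  let ?N = "PiM UNIV (\<lambda>_::nat. borel :: complex measure)"
  define E where "E = {y \<in> space ?N. \<forall>m. y m \<in> sector \<alpha> \<theta>c k \<longrightarrow> l < norm (y m)}"
  \<comment> \<open>Pairs of an obstacle configuration and a point visible in it; the section at
    \<open>y\<close> is the union of the visible regions.\<close>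
  define R where "R = {z \<in> space (?N \<Otimes>\<^sub>M borel). \<exists>i\<in>{1..k}. snd z \<in> sector \<alpha> \<theta>c i \<and> norm (snd z) \<le> dmax
     \<and> (\<forall>m. fst z m \<in> sector \<alpha> \<theta>c i \<longrightarrow> norm (snd z) < norm (fst z m))}"
  have E: "E \<in> sets ?N" unfolding E_def by measurable
  have R: "R \<in> sets (?N \<Otimes>\<^sub>M borel)" unfolding R_def by measurable
  have R_sec: "Pair y -` R = (\<Union>i\<in>{1..k}. los_region i y)" for y
    by (auto simp: R_def los_region_def space_pair_measure space_PiM)
  have bnd: "bounded (Pair y -` R)" for y
    unfolding R_sec by (auto intro: los_region_bounded)
  have E_iff: "(\<lambda>m. Y m w) \<in> E \<longleftrightarrow> link_established \<alpha> \<theta> \<theta>c Y l w" for w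
    by (simp add: E_def space_PiM link_established_iff)
  have R_iff: "((\<lambda>m. Y m w), x) \<in> R \<longleftrightarrow> x \<in> (\<Union>i\<in>{1..k}. los_region i (\<lambda>m. Y m w))" for w x
    using R_sec by blast
  have "emeasure M {w \<in> space M. link_established \<alpha> \<theta> \<theta>c Y l w \<and> \<not> collision \<alpha> \<theta> \<theta>c dmax X A F Y w}
    = emeasure M {w \<in> space M. (\<lambda>m. Y m w) \<in> E \<and> (\<forall>n. ((\<lambda>m. Y m w), X n w) \<in> R \<longrightarrow> \<not> (A n w \<and> F n w))}"
    unfolding E_iff R_iff collision_iff by (rule arg_cong[where f="emeasure M"]) blast
  also have "\<dots> = (\<integral>\<^sup>+w. ennreal (exp (- (lam_t * rho_a * (\<theta> / (2 * pi)) * measure lborel (Pair (\<lambda>m. Y m w) -` R))))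
         * indicator E (\<lambda>m. Y m w) \<partial>M)"
    by (rule blockage_model_void_prob[OF model E R bnd])
  also have "\<dots> = (\<integral>\<^sup>+w. ennreal (exp (- (\<Sum>i\<in>{1..k}. c * (D i w)\<^sup>2))) * indicator {w. link_established \<alpha> \<theta> \<theta>c Y l w} w \<partial>M)"
  proof (rule nn_integral_cong)
    fix w
    have "lam_t * rho_a * (\<theta> / (2 * pi)) * measure lborel (Pair (\<lambda>m. Y m w) -` R) = (\<Sum>i\<in>{1..k}. c * (D i w)\<^sup>2)"
      unfolding R_sec measure_los_regions sum_distrib_left
      by (intro sum.cong) (auto simp: c_def lam_I_def)
    then show "ennreal (exp (- (lam_t * rho_a * (\<theta> / (2 * pi)) * measure lborel (Pair (\<lambda>m. Y m w) -` R)))) * indicator E (\<lambda>m. Y m w)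
      = ennreal (exp (- (\<Sum>i\<in>{1..k}. c * (D i w)\<^sup>2))) * indicator {w. link_established \<alpha> \<theta> \<theta>c Y l w} w"
      by (simp add: indicator_def E_iff)
  qed
  finally show ?thesis .
qed

lemma prob_link_no_collision:
  assumes l: "0 \<le> l" "l \<le> dmax"
  shows "prob {w \<in> space M. link_established \<alpha> \<theta> \<theta>c Y l w \<and> \<not> collision \<alpha> \<theta> \<theta>c dmax X A F Y w}
    = phi 0 ^ (k - 1) * phi l" (is "prob ?V = _")
proof -
  \<comment> \<open>Since every \<open>D i w\<close> is nonnegative, threshold 0 imposes nothing.
    All sectors can then be treated by one formula, and only sector \<open>k\<close> sees the
    link.\<close>
  define L where "L i = (if i = k then l else 0)" for i
  have k_in: "k \<in> {1..k}" using k_pos by simp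
  define g where "g i x = ennreal (exp (- (c * x\<^sup>2))) * indicator {L i..} x" for i and x :: real
  have [measurable]: "g i \<in> borel_measurable borel" for i unfolding g_def by measurable
  have "emeasure M ?V = (\<integral>\<^sup>+w. (\<Prod>i\<in>{1..k}. g i (D i w)) \<partial>M)"
    unfolding emeasure_link_no_collision
  proof (rule nn_integral_cong_AE)
    show "AE w in M. ennreal (exp (- (\<Sum>i\<in>{1..k}. c * (D i w)\<^sup>2))) * indicator {w. link_established \<alpha> \<theta> \<theta>c Y l w} w
      = (\<Prod>i\<in>{1..k}. g i (D i w))"
      using AE_link_established_iff[OF l(2)]
    proof eventually_elim
      fix w assume est: "link_established \<alpha> \<theta> \<theta>c Y l w \<longleftrightarrow> l \<le> D k w"
      have "(\<Prod>i\<in>{1..k}. g i (D i w))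
        = (\<Prod>i\<in>{1..k}. ennreal (exp (- (c * (D i w)\<^sup>2)))) * (\<Prod>i\<in>{1..k}. indicator {L i..} (D i w))"
        by (simp add: g_def prod.distrib)
      also have "(\<Prod>i\<in>{1..k}. ennreal (exp (- (c * (D i w)\<^sup>2)))) = ennreal (exp (- (\<Sum>i\<in>{1..k}. c * (D i w)\<^sup>2)))"
        by (simp add: prod_ennreal exp_sum flip: sum_negf)
      also have "(\<Prod>i\<in>{1..k}. indicator {L i..} (D i w)) = (\<Prod>i\<in>{1..k}. if i = k then indicator {l..} (D k w) else (1 :: ennreal))"
        by (intro prod.cong) (auto simp: L_def D_bounds)
      also have "\<dots> = indicator {w. link_established \<alpha> \<theta> \<theta>c Y l w} w"
        using k_in by (simp add: est indicator_def)
      finally show "ennreal (exp (- (\<Sum>i\<in>{1..k}. c * (D i w)\<^sup>2))) * indicator {w. link_established \<alpha> \<theta> \<theta>c Y l w} w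
        = (\<Prod>i\<in>{1..k}. g i (D i w))" ..
    qed
  qed
  also have "\<dots> = (\<Prod>i\<in>{1..k}. \<integral>\<^sup>+w. g i (D i w) \<partial>M)"
  proof (rule indep_vars_nn_integral)
    have "indep_vars (\<lambda>_. borel) D {1..k}"
      unfolding D_def[abs_def] using k_pos pos sectors_disjoint
      by (intro poisson_indep_nearest[OF obstacles]) auto
    then show "indep_vars (\<lambda>_. borel) (\<lambda>i w. g i (D i w)) {1..k}"
      by (rule indep_vars_compose2) auto
  qed auto
  also have "\<dots> = (\<Prod>i\<in>{1..k}. ennreal (phi (L i)))"
  proof (rule prod.cong[OF refl])
    fix i
    show "(\<integral>\<^sup>+w. g i (D i w) \<partial>M) = ennreal (phi (L i))"
      unfolding g_def phi_def
      by (rule nn_integral_exp_rayleigh_tail[OF D_measurable D_bounds prob_le_D bc_pos])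
        (use l pos in \<open>auto simp: L_def\<close>)
  qed
  also have "\<dots> = ennreal (\<Prod>i\<in>{1..k}. phi (L i))"
    by (simp add: prod_ennreal phi_nonneg)
  also have "(\<Prod>i\<in>{1..k}. phi (L i)) = phi (L k) * (\<Prod>i\<in>{1..k} - {k}. phi (L i))"
    by (rule prod.remove) (use k_in in auto)
  also have "(\<Prod>i\<in>{1..k} - {k}. phi (L i)) = (\<Prod>i\<in>{1..k} - {k}. phi 0)"
    by (rule prod.cong) (auto simp: L_def)
  also have "\<dots> = phi 0 ^ (k - 1)"
    using k_in by simp
  finally have "ennreal (prob ?V) = ennreal (phi 0 ^ (k - 1) * phi l)"
    by (simp add: emeasure_eq_measure L_def mult.commute)
  then show ?thesis using phi_nonneg by simp
qed

text \<open>The link event has the positive probability \<open>exp (- (b * l\<^sup>2))\<close>;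
  dividing the joint probability by it creates the factor
  \<open>exp (b * l\<^sup>2)\<close>.\<close>

lemma cond_collision_prob_eq:
  assumes l: "0 \<le> l" "l \<le> dmax"
  shows "cond_collision_prob M \<alpha> \<theta> \<theta>c dmax X A F Y l = 1 - phi 0 ^ (k - 1) * (phi l * exp (b * l\<^sup>2))"
proof -
  let ?e = "\<lambda>w. link_established \<alpha> \<theta> \<theta>c Y l w" and ?c = "\<lambda>w. collision \<alpha> \<theta> \<theta>c dmax X A F Y w"
  have "{w \<in> space M. ?c w \<and> ?e w} = {w \<in> space M. ?e w} - {w \<in> space M. ?e w \<and> \<not> ?c w}" by auto
  also have "prob \<dots> = exp (- (b * l\<^sup>2)) - phi 0 ^ (k - 1) * phi l"
    by (subst finite_measure_Diff) (auto simp: prob_link_established prob_link_no_collision l)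
  finally have "cond_collision_prob M \<alpha> \<theta> \<theta>c dmax X A F Y l
      = (exp (- (b * l\<^sup>2)) - phi 0 ^ (k - 1) * phi l) / exp (- (b * l\<^sup>2))"
    by (simp add: cond_collision_prob_def cond_prob_def prob_link_established l)
  then show ?thesis by (simp add: diff_divide_distrib exp_minus divide_inverse algebra_simps)
qed

lemma collision_prob_eq:
  "collision_prob M \<alpha> \<theta> \<theta>c dmax X A F Y
    = 1 - (LBINT l=0..dmax. phi 0 ^ (k - 1) * (phi l * exp (b * l\<^sup>2)) * (2 * l / dmax\<^sup>2))"
proof -
  define h where "h l = phi 0 ^ (k - 1) * (phi l * exp (b * l\<^sup>2)) * (2 * l / dmax\<^sup>2)" for l
  have "collision_prob M \<alpha> \<theta> \<theta>c dmax X A F Y = (LBINT l=0..dmax. 2 * l / dmax\<^sup>2 - h l)"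
    unfolding collision_prob_def
    \<comment> \<open>Only interior points of the interval matter, and there the density is its
      nonzero branch.\<close>
    by (rule interval_integral_cong)
      (use pos in \<open>auto simp: cond_collision_prob_eq link_length_density_def h_def einterval_iff left_diff_distrib diff_divide_distrib\<close>)
  also have "\<dots> = (LBINT l=0..dmax. 2 * l / dmax\<^sup>2) - (LBINT l=0..dmax. h l)"
  proof (rule interval_lebesgue_integral_diff)
    show "interval_lebesgue_integrable lborel 0 (ereal dmax) (\<lambda>l. 2 * l / dmax\<^sup>2)"
      unfolding zero_ereal_def using pos
      by (intro interval_integrable_continuous_on) (auto intro!: continuous_intros)
    show "interval_lebesgue_integrable lborel 0 (ereal dmax) h"
      unfolding zero_ereal_def h_def phi_def using pos bc_pos
      by (intro interval_integrable_continuous_on) (auto intro!: continuous_intros)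
  qed
  also have "(LBINT l=0..dmax. 2 * l / dmax\<^sup>2) = 1"
  proof -
    have "(LBINT l=ereal 0..ereal dmax. 2 * l / dmax\<^sup>2) = dmax\<^sup>2 / dmax\<^sup>2 - 0\<^sup>2 / dmax\<^sup>2"
    proof (rule interval_integral_FTC_finite)
      fix x
      have "((\<lambda>l. l\<^sup>2 / dmax\<^sup>2) has_real_derivative 2 * x / dmax\<^sup>2) (at x)"
        by (rule DERIV_cdivide) (auto intro!: derivative_eq_intros)
      then show "((\<lambda>l. l\<^sup>2 / dmax\<^sup>2) has_vector_derivative 2 * x / dmax\<^sup>2) (at x within {min 0 dmax..max 0 dmax})"
        by (simp add: has_real_derivative_iff_has_vector_derivative has_vector_derivative_at_within)
    qed (use pos in \<open>auto intro!: continuous_intros\<close>)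
    also have "\<dots> = 1" using pos by simp
    finally show ?thesis by (simp only: zero_ereal_def)
  qed
  finally show ?thesis by (simp add: h_def)
qed

end

theorem proposition1:
  fixes M :: "'w measure"
    and X Y :: "nat \<Rightarrow> 'w \<Rightarrow> complex" and A F :: "nat \<Rightarrow> 'w \<Rightarrow> bool"
    and lam_t lam_o lam_I rho_a dmax \<theta> \<theta>c \<alpha> :: real
  assumes "0 < lam_t" and "0 < lam_o" and "0 < rho_a" and "rho_a \<le> 1" and "0 < dmax"
    and "0 < \<theta>" and "\<theta> \<le> 2 * pi" and "0 < \<theta>c" and "\<theta> / \<theta>c \<in> \<int>"
    and "lam_I = rho_a * lam_t * \<theta> / (2 * pi)"
    and "blockage_interference_model M X A F Y lam_t lam_o rho_a \<theta>"
  shows "collision_prob M \<alpha> \<theta> \<theta>c dmax X A F Y =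
    1 - (LBINT l=0..dmax.
      ((lam_o + lam_I * exp (- ((lam_o + lam_I) * \<theta>c * dmax\<^sup>2 / 2))) / (lam_o + lam_I))
        ^ (nat \<lceil>\<theta> / \<theta>c\<rceil> - 1)
      * (exp (- (lam_I * \<theta>c * l\<^sup>2 / 2))
         - lam_I * exp (lam_o * \<theta>c * l\<^sup>2 / 2) / (lam_o + lam_I)
           * (exp (- ((lam_o + lam_I) * \<theta>c * l\<^sup>2 / 2)) - exp (- ((lam_o + lam_I) * \<theta>c * dmax\<^sup>2 / 2))))
      * (2 * l / dmax\<^sup>2))"
proof -
  interpret S: blockage_setup M X Y A F lam_t lam_o rho_a dmax \<theta> \<theta>c \<alpha>
    using assms by unfold_locales auto
  have lam_I: "S.lam_I = lam_I" by (simp add: S.lam_I_def assms)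
  have lam_I_pos: "0 < lam_I" using S.lam_I_pos by (simp add: lam_I)
  have sum: "S.b + S.c = (lam_o + lam_I) * \<theta>c / 2"
    by (simp add: S.b_def S.c_def lam_I algebra_simps add_divide_distrib)
  have ratio: "S.c / (S.b + S.c) = lam_I / (lam_o + lam_I)"
    unfolding sum using assms(8) by (simp add: S.c_def lam_I)
  have phi: "S.phi l = exp (- ((lam_o + lam_I) * \<theta>c * l\<^sup>2 / 2)) - lam_I / (lam_o + lam_I)
      * (exp (- ((lam_o + lam_I) * \<theta>c * l\<^sup>2 / 2)) - exp (- ((lam_o + lam_I) * \<theta>c * dmax\<^sup>2 / 2)))" for l
    unfolding S.phi_def ratio unfolding sum by simp
  have phi0: "S.phi 0 = (lam_o + lam_I * exp (- ((lam_o + lam_I) * \<theta>c * dmax\<^sup>2 / 2))) / (lam_o + lam_I)"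
    unfolding phi using assms(2) lam_I_pos by (simp add: field_simps)
  \<comment> \<open>Multiplication by \<open>exp (b * l\<^sup>2)\<close> cancels the obstacle part
    of the first exponential, leaving only \<open>lam_I\<close> there; in the second term the factor
    stays outside the difference.\<close>
  have phil: "S.phi l * exp (S.b * l\<^sup>2) = exp (- (lam_I * \<theta>c * l\<^sup>2 / 2))
      - lam_I * exp (lam_o * \<theta>c * l\<^sup>2 / 2) / (lam_o + lam_I)
        * (exp (- ((lam_o + lam_I) * \<theta>c * l\<^sup>2 / 2)) - exp (- ((lam_o + lam_I) * \<theta>c * dmax\<^sup>2 / 2)))" for l
  proof -
    have "exp (- ((lam_o + lam_I) * \<theta>c * l\<^sup>2 / 2)) * exp (lam_o * \<theta>c * l\<^sup>2 / 2) = exp (- (lam_I * \<theta>c * l\<^sup>2 / 2))"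
      unfolding exp_add[symmetric] by (rule arg_cong[where f=exp]) (simp add: field_simps)
    then show ?thesis
      unfolding phi left_diff_distrib by (simp add: S.b_def)
  qed
  show ?thesis
    unfolding S.collision_prob_eq phil phi0 S.k_def num_sectors_def ..
qed

end
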